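(* Let $X$ be a real-valued random variable having finite moments of all orders, and suppose that its annihilation operator is a linear combination of translation operators, $$a^-=\sum_{i=1}^n c_i\,\mathcal{T}_{d_i},$$ where $c_1,\dots,c_n$ are nonzero real numbers with $\sum_{i=1}^nc_i=0$ and $d_1,\dots,d_n$ are distinct real numbers. Then $c_i/d_i>0$ for every $i$ with $d_i\ne0$, and $X$ is a shifted linear combination of independent Poisson random variables: there exist a constant $b\in\mathbb{R}$ and independent Poisson random variables $Y_i$ with means $c_i/d_i$, for $1\le i\le n$ with $d_i\neq 0$, such that $X$ has the same distribution as $$b+\sum_{i:\,d_i\ne0}d_iY_i .$$
   Context: Let $X$ be a real-valued random variable with finite moments of all orders on a probability space $(\Omega,\mathcal F,P)$. Let $F$ be the space of random variables $f(X)$ with $f\in\mathbb{C}[x]$, let $F_n$ be the subspace of those $f(X)$ with $\deg f\le n$, $F_{-1}=\{0\}$, and $G_n=F_n\ominus F_{n-1}$ (orthogonal complement in $L^2(\Omega,P)$). Multiplication by $X$ maps $G_n$ into $G_{n-1}\oplus G_n\oplus G_{n+1}$ (with $G_{-1}=\{0\}$). The annihilation operator $a^-:F\to F$ is the linear operator which, on $G_n$, sends $g$ to the orthogonal projection of $Xg$ onto $G_{n-1}$ (and is $0$ on $G_0$). For $c\in\mathbb{C}$, $\mathcal{T}_c$ is the translation operator $\mathcal{T}_cf(X)=f(X+c)$. The identity $a^-=\sum_{i=1}^nc_i\mathcal{T}_{d_i}$ means that for every polynomial $f\in\mathbb{C}[x]$, $a^-(f(X))=\sum_{i=1}^nc_if(X+d_i)$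 almost surely. *)

theory Defs
  imports "HOL-Probability.Probability" "HOL-Computational_Algebra.Polynomial"
begin

text \<open>
  Random variables are represented by functions, and identities between them are stated
  almost everywhere; the quotient by null sets is not formed.
\<close>

definition finite_moments :: "'a measure \<Rightarrow> ('a \<Rightarrow> real) \<Rightarrow> bool" where
  "finite_moments M X \<longleftrightarrow> (\<forall>k::nat. integrable M (\<lambda>\<omega>. X \<omega> ^ k))"

definition L2_inner :: "'a measure \<Rightarrow> ('a \<Rightarrow> complex) \<Rightarrow> ('a \<Rightarrow> complex) \<Rightarrow> complex" where
  "L2_inner M u v = (\<integral>\<omega>. u \<omega> * cnj (v \<omega>) \<partial>M)"

definition translate_rv :: "complex \<Rightarrow> complex poly \<Rightarrow> ('a \<Rightarrow> real) \<Rightarrow> 'a \<Rightarrow> complex" where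
  "translate_rv c f X = (\<lambda>\<omega>. poly f (complex_of_real (X \<omega>) + c))"

definition poly_rv :: "complex poly \<Rightarrow> ('a \<Rightarrow> real) \<Rightarrow> 'a \<Rightarrow> complex" where
  "poly_rv f X = (\<lambda>\<omega>. poly f (complex_of_real (X \<omega>)))"

definition poly_space :: "('a \<Rightarrow> real) \<Rightarrow> ('a \<Rightarrow> complex) set" where
  "poly_space X = {poly_rv f X | f. True}"

text \<open>
  The index is an integer so that the convention for index \<open>-1\<close> is covered: the zero
  polynomial counts as having degree below every integer, hence the space is \<open>{0}\<close> for
  negative \<open>n\<close>.
\<close>

definition poly_space_le :: "('a \<Rightarrow> real) \<Rightarrow> int \<Rightarrow> ('a \<Rightarrow> complex) set" where
  "poly_space_le X n = {poly_rv f X | f. f = 0 \<or> int (degree f) \<le> n}"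

definition chaos :: "'a measure \<Rightarrow> ('a \<Rightarrow> real) \<Rightarrow> int \<Rightarrow> ('a \<Rightarrow> complex) set" where
  "chaos M X n = {g \<in> poly_space_le X n. \<forall>h \<in> poly_space_le X (n - 1). L2_inner M g h = 0}"

definition is_orth_proj ::
    "'a measure \<Rightarrow> ('a \<Rightarrow> complex) set \<Rightarrow> ('a \<Rightarrow> complex) \<Rightarrow> ('a \<Rightarrow> complex) \<Rightarrow> bool" where
  "is_orth_proj M V u p \<longleftrightarrow> p \<in> V \<and> (\<forall>h\<in>V. L2_inner M (\<lambda>\<omega>. u \<omega> - p \<omega>) h = 0)"

text \<open>
  The operator is determined only up to almost sure equality of its values, so it is described
  by a predicate; existence and uniqueness in this sense are proved at the end of the theory.
\<close>

definition is_annihilation_operator ::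
    "'a measure \<Rightarrow> ('a \<Rightarrow> real) \<Rightarrow> (('a \<Rightarrow> complex) \<Rightarrow> 'a \<Rightarrow> complex) \<Rightarrow> bool" where
  "is_annihilation_operator M X A \<longleftrightarrow>
     (\<forall>u\<in>poly_space X. A u \<in> poly_space X) \<and>
     (\<forall>u\<in>poly_space X. \<forall>v\<in>poly_space X. (AE \<omega> in M. u \<omega> = v \<omega>) \<longrightarrow> (AE \<omega> in M. A u \<omega> = A v \<omega>)) \<and>
     (\<forall>u\<in>poly_space X. \<forall>v\<in>poly_space X. AE \<omega> in M. A (\<lambda>x. u x + v x) \<omega> = A u \<omega> + A v \<omega>) \<and>
     (\<forall>u\<in>poly_space X. \<forall>z. AE \<omega> in M. A (\<lambda>x. z * u x) \<omega> = z * A u \<omega>) \<and>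
     (\<forall>n::nat. \<forall>g\<in>chaos M X (int n).
        is_orth_proj M (chaos M X (int n - 1)) (\<lambda>\<omega>. complex_of_real (X \<omega>) * g \<omega>) (A g))"


context
  fixes M :: "'a measure" and X :: "'a \<Rightarrow> real"
  assumes meas: "X \<in> borel_measurable M" and mom: "finite_moments M X"
begin

lemma poly_space_le_subset: "u \<in> poly_space_le X n \<Longrightarrow> u \<in> poly_space X"
  unfolding poly_space_le_def poly_space_def by blast

lemma poly_space_le_mono: "u \<in> poly_space_le X n \<Longrightarrow> n \<le> m \<Longrightarrow> u \<in> poly_space_le X m"
  unfolding poly_space_le_def by force

lemma poly_space_imp_le: "u \<in> poly_space X \<Longrightarrow> \<exists>n::nat. u \<in> poly_space_le X (int n)"
  unfolding poly_space_le_def poly_space_def by blast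

lemma poly_space_le_neg: "n < 0 \<Longrightarrow> poly_space_le X n = {\<lambda>_. 0}"
  unfolding poly_space_le_def poly_rv_def by force

lemma poly_space_le_lincomb:
  assumes "u \<in> poly_space_le X n" "v \<in> poly_space_le X n"
  shows "(\<lambda>\<omega>. a * u \<omega> + b * v \<omega>) \<in> poly_space_le X n"
proof -
  obtain f g where f: "u = poly_rv f X" "f = 0 \<or> int (degree f) \<le> n"
    and g: "v = poly_rv g X" "g = 0 \<or> int (degree g) \<le> n"
    using assms unfolding poly_space_le_def by blast
  let ?h = "smult a f + smult b g"
  have "degree ?h \<le> max (degree f) (degree g)"
    by (meson degree_add_le_max degree_smult_le max.mono order_trans)
  then have "?h = 0 \<or> int (degree ?h) \<le> n"
    using f(2) g(2) by fastforce
  moreover have "(\<lambda>\<omega>. a * u \<omega> + b * v \<omega>) = poly_rv ?h X"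
    by (simp add: f g poly_rv_def)
  ultimately show ?thesis unfolding poly_space_le_def by blast
qed

lemma poly_space_lincomb:
  assumes "u \<in> poly_space X" "v \<in> poly_space X"
  shows "(\<lambda>\<omega>. a * u \<omega> + b * v \<omega>) \<in> poly_space X"
proof -
  obtain m n :: nat where "u \<in> poly_space_le X (int m)" "v \<in> poly_space_le X (int n)"
    using assms poly_space_imp_le by blast
  then have "u \<in> poly_space_le X (int (max m n))" "v \<in> poly_space_le X (int (max m n))"
    using poly_space_le_mono by (meson max.cobounded1 max.cobounded2 of_nat_mono)+
  then show ?thesis using poly_space_le_lincomb poly_space_le_subset by blast
qed

lemma poly_space_mult:
  assumes "u \<in> poly_space X" shows "(\<lambda>\<omega>. complex_of_real (X \<omega>) * u \<omega>) \<in> poly_space X"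
proof -
  obtain f where "u = poly_rv f X" using assms unfolding poly_space_def by blast
  then have "(\<lambda>\<omega>. complex_of_real (X \<omega>) * u \<omega>) = poly_rv (pCons 0 f) X"
    by (simp add: poly_rv_def)
  then show ?thesis unfolding poly_space_def by blast
qed

lemma integrable_poly_rv: "integrable M (poly_rv f X)"
proof -
  have "integrable M (\<lambda>\<omega>. coeff f i * complex_of_real (X \<omega> ^ i))" for i
    using mom unfolding finite_moments_def
    by (intro integrable_mult_right integrable_of_real) blast
  then have "integrable M (\<lambda>\<omega>. \<Sum>i\<le>degree f. coeff f i * complex_of_real (X \<omega> ^ i))"
    by (intro Bochner_Integration.integrable_sum) blast
  then show ?thesis by (simp add: poly_rv_def poly_altdef)
qed

lemma cnj_poly: "\<exists>g. \<forall>x::real. cnj (poly f (of_real x)) = poly g (of_real x)"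
proof (induction f)
  case (pCons a f)
  then obtain g where "\<forall>x::real. cnj (poly f (of_real x)) = poly g (of_real x)" by blast
  then have "\<forall>x::real. cnj (poly (pCons a f) (of_real x)) = poly (pCons (cnj a) g) (of_real x)"
    by simp
  then show ?case by blast
qed (auto intro!: exI[of _ 0])

lemma integrable_inner:
  assumes "u \<in> poly_space X" "v \<in> poly_space X"
  shows "integrable M (\<lambda>\<omega>. u \<omega> * cnj (v \<omega>))"
proof -
  obtain f g where fg: "u = poly_rv f X" "v = poly_rv g X"
    using assms unfolding poly_space_def by blast
  obtain h where "\<forall>x::real. cnj (poly g (of_real x)) = poly h (of_real x)"
    using cnj_poly by blast
  then have "(\<lambda>\<omega>. u \<omega> * cnj (v \<omega>)) = poly_rv (f * h) X"
    by (simp add: fg poly_rv_def)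
  then show ?thesis using integrable_poly_rv by simp
qed

lemma inner_lincomb:
  assumes "u \<in> poly_space X" "v \<in> poly_space X" "h \<in> poly_space X"
  shows "L2_inner M (\<lambda>\<omega>. a * u \<omega> + b * v \<omega>) h = a * L2_inner M u h + b * L2_inner M v h"
proof -
  have "L2_inner M (\<lambda>\<omega>. a * u \<omega> + b * v \<omega>) h =
      (\<integral>\<omega>. a * (u \<omega> * cnj (h \<omega>)) + b * (v \<omega> * cnj (h \<omega>)) \<partial>M)"
    unfolding L2_inner_def by (simp add: algebra_simps)
  also have "\<dots> = a * L2_inner M u h + b * L2_inner M v h"
    unfolding L2_inner_def using assms
    by (subst Bochner_Integration.integral_add) (auto intro!: integrable_mult_right integrable_inner)
  finally show ?thesis .
qed

lemma inner_diff:
  assumes "u \<in> poly_space X" "v \<in> poly_space X" "h \<in> poly_space X"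
  shows "L2_inner M (\<lambda>\<omega>. u \<omega> - v \<omega>) h = L2_inner M u h - L2_inner M v h"
  using inner_lincomb[OF assms, of 1 "-1"] by simp

lemma inner_cnj: "L2_inner M u v = cnj (L2_inner M v u)"
proof -
  have "cnj (L2_inner M v u) = (\<integral>\<omega>. cnj (v \<omega> * cnj (u \<omega>)) \<partial>M)"
    unfolding L2_inner_def by (rule Bochner_Integration.integral_cnj [symmetric])
  then show ?thesis by (simp add: L2_inner_def mult.commute)
qed

lemma inner_cong_AE:
  assumes "u \<in> poly_space X" "u' \<in> poly_space X" "v \<in> poly_space X" "v' \<in> poly_space X"
    and "AE \<omega> in M. u \<omega> = u' \<omega>" "AE \<omega> in M. v \<omega> = v' \<omega>"
  shows "L2_inner M u v = L2_inner M u' v'"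
  unfolding L2_inner_def
  by (rule integral_cong_AE)
     (use assms integrable_inner in \<open>auto intro: borel_measurable_integrable\<close>)

lemma inner_self_zero:
  assumes "u \<in> poly_space X" "L2_inner M u u = 0"
  shows "AE \<omega> in M. u \<omega> = 0"
proof -
  have int: "integrable M (\<lambda>\<omega>. complex_of_real ((norm (u \<omega>))\<^sup>2))"
    using integrable_inner[OF assms(1) assms(1)] by (simp add: complex_norm_square [symmetric])
  then have int': "integrable M (\<lambda>\<omega>. (norm (u \<omega>))\<^sup>2)"
    by (simp only: complex_of_real_integrable_eq)
  have "complex_of_real (\<integral>\<omega>. (norm (u \<omega>))\<^sup>2 \<partial>M) = L2_inner M u u"
    unfolding L2_inner_def integral_complex_of_real [symmetric] complex_norm_square ..
  then have "(\<integral>\<omega>. (norm (u \<omega>))\<^sup>2 \<partial>M) = 0" using assms by simp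
  then have "AE \<omega> in M. (norm (u \<omega>))\<^sup>2 = 0"
    using integral_nonneg_eq_0_iff_AE[OF int'] by simp
  then show ?thesis by simp
qed

lemma proj_exists:
  "u \<in> poly_space X \<Longrightarrow> \<exists>p. is_orth_proj M (poly_space_le X (int n - 1)) u p"
proof (induction n arbitrary: u)
  case 0
  then show ?case
    by (intro exI[of _ "\<lambda>_. 0"]) (simp add: is_orth_proj_def poly_space_le_neg L2_inner_def)
next
  case (Suc n)
  let ?F = "poly_space_le X (int n - 1)" and ?G = "poly_space_le X (int n)"
  define m where "m = poly_rv (monom 1 n) X"
  have mG: "m \<in> ?G" unfolding m_def poly_space_le_def
    by (auto intro!: exI[of _ "monom 1 n"] simp: degree_monom_eq)
  obtain q where q: "is_orth_proj M ?F m q"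
    using Suc.IH mG poly_space_le_subset by blast
  obtain p where p: "is_orth_proj M ?F u p"
    using Suc by blast
  have pq: "p \<in> ?G" "q \<in> ?G"
    using p q poly_space_le_mono unfolding is_orth_proj_def by (meson diff_le_self zle_diff1_eq order_refl less_imp_le)+
  define e where "e = (\<lambda>\<omega>. m \<omega> - q \<omega>)"
  have eG: "e \<in> ?G" using poly_space_le_lincomb[OF mG pq(2), of 1 "-1"] by (simp add: e_def)
  note sub = poly_space_le_subset
  have e_perp: "L2_inner M e h = 0" if "h \<in> ?F" for h
    using q that unfolding is_orth_proj_def e_def by blast
  define a where "a = L2_inner M u e / L2_inner M e e"
  define r where "r = (\<lambda>\<omega>. p \<omega> + a * e \<omega>)"
  have rG: "r \<in> ?G" using poly_space_le_lincomb[OF pq(1) eG, of 1 a] by (simp add: r_def)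
  have up: "(\<lambda>\<omega>. u \<omega> - p \<omega>) \<in> poly_space X"
    using poly_space_lincomb[OF Suc.prems sub[OF pq(1)], of 1 "-1"] by simp
  have ur: "L2_inner M (\<lambda>\<omega>. u \<omega> - r \<omega>) h = L2_inner M (\<lambda>\<omega>. u \<omega> - p \<omega>) h - a * L2_inner M e h"
    if "h \<in> poly_space X" for h
    using inner_lincomb[OF up sub[OF eG] that, of 1 "-a"] by (simp add: r_def algebra_simps)
  have ue: "L2_inner M (\<lambda>\<omega>. u \<omega> - r \<omega>) e = 0"
  proof -
    have "p \<in> ?F" using p unfolding is_orth_proj_def by blast
    then have "L2_inner M p e = 0" using e_perp inner_cnj[of p e] by simp
    then have 1: "L2_inner M (\<lambda>\<omega>. u \<omega> - r \<omega>) e = L2_inner M u e - a * L2_inner M e e"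
      using ur[OF sub[OF eG]] inner_diff[OF Suc.prems sub[OF pq(1)] sub[OF eG]] by simp
    show ?thesis
    proof (cases "L2_inner M e e = 0")
      case True
      then have "AE \<omega> in M. e \<omega> = 0" using inner_self_zero sub eG by blast
      then have "L2_inner M u e = L2_inner M u (\<lambda>_. 0)"
        using poly_space_le_lincomb[OF eG eG, of 0 0]
        by (intro inner_cong_AE) (auto intro: sub Suc.prems eG)
      then show ?thesis using 1 True by (simp add: L2_inner_def)
    qed (use 1 in \<open>simp add: a_def\<close>)
  qed
  have uF: "L2_inner M (\<lambda>\<omega>. u \<omega> - r \<omega>) h = 0" if "h \<in> ?F" for h
    using ur[OF sub[OF that]] e_perp[OF that] p that unfolding is_orth_proj_def by simp
  have "L2_inner M (\<lambda>\<omega>. u \<omega> - r \<omega>) h = 0" if h: "h \<in> ?G" for h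
  proof -
    obtain f where f: "h = poly_rv f X" "f = 0 \<or> int (degree f) \<le> int n"
      using h unfolding poly_space_le_def by blast
    let ?f = "f - monom (coeff f n) n"
    let ?k = "poly_rv ?f X"
    have "coeff ?f i = 0" if "i \<ge> n" for i
      using f(2) that by (cases "i = n") (auto simp: coeff_eq_0)
    then have "?f = 0 \<or> degree ?f < n"
      by (metis leading_coeff_0_iff not_le)
    then have k: "?k \<in> ?F" unfolding poly_space_le_def
      by (intro CollectI exI[of _ ?f]) auto
    let ?c = "coeff f n"
    define l where "l = (\<lambda>\<omega>. ?k \<omega> + ?c * q \<omega>)"
    have qF: "q \<in> ?F" using q unfolding is_orth_proj_def by blast
    have lF: "l \<in> ?F" using poly_space_le_lincomb[OF k qF, of 1 ?c] by (simp add: l_def)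
    have heq: "h = (\<lambda>\<omega>. 1 * l \<omega> + ?c * e \<omega>)"
      by (auto simp: f(1) l_def e_def m_def poly_rv_def algebra_simps poly_monom)
    have urX: "(\<lambda>\<omega>. u \<omega> - r \<omega>) \<in> poly_space X"
      using poly_space_lincomb[OF Suc.prems sub[OF rG], of 1 "-1"] by simp
    have "L2_inner M h (\<lambda>\<omega>. u \<omega> - r \<omega>) = 0"
      using ue uF[OF lF] inner_lincomb[OF sub[OF lF] sub[OF eG] urX, of 1 ?c]
        inner_cnj[of l "\<lambda>\<omega>. u \<omega> - r \<omega>"] inner_cnj[of e "\<lambda>\<omega>. u \<omega> - r \<omega>"]
      by (simp add: heq)
    then show ?thesis using inner_cnj[of "\<lambda>\<omega>. u \<omega> - r \<omega>" h] by simp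
  qed
  then show ?case using rG by (auto simp: is_orth_proj_def)
qed

lemma chaos_subset: "g \<in> chaos M X n \<Longrightarrow> g \<in> poly_space_le X n"
  unfolding chaos_def by blast

lemma chaos_lincomb:
  assumes "g \<in> chaos M X n" "h \<in> chaos M X n"
  shows "(\<lambda>\<omega>. a * g \<omega> + b * h \<omega>) \<in> chaos M X n"
proof -
  have "L2_inner M (\<lambda>\<omega>. a * g \<omega> + b * h \<omega>) k = 0" if "k \<in> poly_space_le X (n - 1)" for k
    using assms that inner_lincomb[of g h k a b] poly_space_le_subset
    unfolding chaos_def by auto
  then show ?thesis using assms poly_space_le_lincomb unfolding chaos_def by blast
qed

lemma annihilation_operator_unique:
  assumes A: "is_annihilation_operator M X A" and B: "is_annihilation_operator M X B"
    and u: "u \<in> poly_space X"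
  shows "AE \<omega> in M. A u \<omega> = B u \<omega>"
proof -
  note sub = poly_space_le_subset
  have G: "AE \<omega> in M. A g \<omega> = B g \<omega>" if g: "g \<in> chaos M X (int n)" for n g
  proof -
    let ?V = "chaos M X (int n - 1)" and ?w = "\<lambda>\<omega>. complex_of_real (X \<omega>) * g \<omega>"
    have pA: "is_orth_proj M ?V ?w (A g)" and pB: "is_orth_proj M ?V ?w (B g)"
      using A B g unfolding is_annihilation_operator_def by blast+
    then have V: "A g \<in> ?V" "B g \<in> ?V" unfolding is_orth_proj_def by blast+
    let ?d = "\<lambda>\<omega>. A g \<omega> - B g \<omega>"
    have d: "?d \<in> ?V" using chaos_lincomb[OF V, of 1 "-1"] by simp
    have w: "?w \<in> poly_space X" using g chaos_subset sub poly_space_mult by blast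
    note s = sub[OF chaos_subset]
    have "L2_inner M ?w ?d - L2_inner M (A g) ?d = 0" "L2_inner M ?w ?d - L2_inner M (B g) ?d = 0"
      using pA pB d inner_diff[OF w s[OF V(1)] s[OF d]] inner_diff[OF w s[OF V(2)] s[OF d]]
      unfolding is_orth_proj_def by auto
    then have "L2_inner M ?d ?d = 0"
      using inner_diff[OF s[OF V(1)] s[OF V(2)] s[OF d]] by simp
    then show ?thesis using inner_self_zero[OF s[OF d]] by simp
  qed
  have "AE \<omega> in M. A u \<omega> = B u \<omega>" if "u \<in> poly_space_le X (int n - 1)" for n u
    using that
  proof (induction n arbitrary: u)
    case 0
    then have "u \<in> chaos M X (int 0)"
      using poly_space_le_mono[of u "-1" 0]
      by (simp add: chaos_def poly_space_le_neg L2_inner_def)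
    then show ?case by (rule G)
  next
    case (Suc n)
    then have u: "u \<in> poly_space_le X (int n)" by simp
    obtain p where p: "is_orth_proj M (poly_space_le X (int n - 1)) u p"
      using proj_exists sub u by blast
    then have pF: "p \<in> poly_space_le X (int n - 1)" unfolding is_orth_proj_def by blast
    then have pG: "p \<in> poly_space_le X (int n)" using poly_space_le_mono by force
    let ?g = "\<lambda>\<omega>. u \<omega> - p \<omega>"
    have g: "?g \<in> chaos M X (int n)"
      using p poly_space_le_lincomb[OF u pG, of 1 "-1"] unfolding is_orth_proj_def chaos_def by simp
    have eq: "(\<lambda>\<omega>. p \<omega> + ?g \<omega>) = u" by simp
    have add: "AE \<omega> in M. C (\<lambda>x. p x + ?g x) \<omega> = C p \<omega> + C ?g \<omega>"
      if "is_annihilation_operator M X C" for C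
    proof -
      have "\<forall>u\<in>poly_space X. \<forall>v\<in>poly_space X. AE \<omega> in M. C (\<lambda>x. u x + v x) \<omega> = C u \<omega> + C v \<omega>"
        using that unfolding is_annihilation_operator_def by blast
      from bspec[OF bspec[OF this sub[OF pF]] sub[OF chaos_subset[OF g]]] show ?thesis .
    qed
    show ?case
      using add[OF A] add[OF B] G[OF g] Suc.IH[OF pF] unfolding eq by eventually_elim simp
  qed
  moreover obtain n where "u \<in> poly_space_le X (int (Suc n) - 1)"
    using poly_space_imp_le[OF u] by auto
  ultimately show ?thesis by blast
qed

lemma annihilation_operator_exists: "\<exists>A. is_annihilation_operator M X A"
proof -
  note sub = poly_space_le_subset
  define m where "m n = poly_rv (monom 1 n) X" for n
  have mG: "m n \<in> poly_space_le X (int n)" for n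
    unfolding m_def poly_space_le_def
    by (auto intro!: exI[of _ "monom 1 n"] simp: degree_monom_eq)
  have "\<forall>n. \<exists>p. is_orth_proj M (poly_space_le X (int n - 1)) (m n) p"
    using proj_exists sub mG by blast
  then obtain q where q: "\<And>n. is_orth_proj M (poly_space_le X (int n - 1)) (m n) (q n)"
    by metis
  have qF: "q n \<in> poly_space_le X (int n - 1)" for n
    using q unfolding is_orth_proj_def by blast
  have qG: "q n \<in> poly_space_le X (int n)" for n
    using poly_space_le_mono[OF qF] by force
  define e where "e n = (\<lambda>\<omega>. m n \<omega> - q n \<omega>)" for n
  have e: "e n \<in> chaos M X (int n)" for n
    using q[of n] poly_space_le_lincomb[OF mG qG, of 1 n "-1"]
    unfolding is_orth_proj_def chaos_def e_def by simp
  note eF = chaos_subset[OF e] and eX = sub[OF chaos_subset[OF e]]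
  define \<alpha> where "\<alpha> n u = L2_inner M u (e n) / L2_inner M (e n) (e n)" for n u
  define \<beta> where
    "\<beta> n = L2_inner M (\<lambda>\<omega>. complex_of_real (X \<omega>) * e n \<omega>) (e (n - 1)) / L2_inner M (e (n - 1)) (e (n - 1))"
    for n :: nat
  define A where "A u = (\<lambda>\<omega>. \<Sum>n | 1 \<le> n \<and> \<alpha> n u \<noteq> 0. \<alpha> n u * \<beta> n * e (n - 1) \<omega>)" for u
  have perp: "\<alpha> n u = 0" if "u \<in> poly_space_le X (int N)" "N < n" for u N n
  proof -
    have "u \<in> poly_space_le X (int n - 1)"
      using that by (intro poly_space_le_mono[OF that(1)]) simp
    then have "L2_inner M (e n) u = 0" using e[of n] unfolding chaos_def by blast
    then show ?thesis using inner_cnj[of u "e n"] by (simp add: \<alpha>_def)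
  qed
  have A_eq: "A u = (\<lambda>\<omega>. \<Sum>n=1..N. \<alpha> n u * \<beta> n * e (n - 1) \<omega>)"
    if u: "u \<in> poly_space_le X (int N)" for u N
  proof
    fix \<omega>
    have "{n. 1 \<le> n \<and> \<alpha> n u \<noteq> 0} \<subseteq> {1..N}"
      using perp[OF u] by (auto simp: not_less [symmetric])
    then show "A u \<omega> = (\<Sum>n=1..N. \<alpha> n u * \<beta> n * e (n - 1) \<omega>)"
      unfolding A_def by (intro sum.mono_neutral_left) auto
  qed
  have sum_mem: "(\<lambda>\<omega>. \<Sum>n\<in>S. a n * e (n - 1) \<omega>) \<in> poly_space X" if "finite S" for S a
    using that
  proof induction
    case empty
    show ?case using poly_space_lincomb[OF eX eX, of 0 0 0 0] by simp
  next
    case (insert x S)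
    then show ?case using poly_space_lincomb[OF eX insert.IH, of "a x" "x - 1" 1] by simp
  qed
  have mem: "A u \<in> poly_space X" if u: "u \<in> poly_space X" for u
  proof -
    obtain N where "u \<in> poly_space_le X (int N)" using poly_space_imp_le u by blast
    then show ?thesis using sum_mem[of "{1..N}" "\<lambda>n. \<alpha> n u * \<beta> n"] by (simp add: A_eq)
  qed
  have lin: "A (\<lambda>x. a * u x + b * v x) = (\<lambda>\<omega>. a * A u \<omega> + b * A v \<omega>)"
    if u: "u \<in> poly_space X" and v: "v \<in> poly_space X" for u v a b
  proof -
    obtain N1 N2 where N: "u \<in> poly_space_le X (int N1)" "v \<in> poly_space_le X (int N2)"
      using poly_space_imp_le u v by blast
    define N where "N = max N1 N2"
    have uv: "u \<in> poly_space_le X (int N)" "v \<in> poly_space_le X (int N)"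
      using N by (auto simp: N_def elim: poly_space_le_mono)
    have "\<alpha> n (\<lambda>x. a * u x + b * v x) = a * \<alpha> n u + b * \<alpha> n v" for n
      using inner_lincomb[OF u v eX] by (simp add: \<alpha>_def add_divide_distrib)
    then show ?thesis
      using A_eq[OF uv(1)] A_eq[OF uv(2)] A_eq[OF poly_space_le_lincomb[OF uv]]
      by (simp add: algebra_simps sum.distrib sum_distrib_left)
  qed
  have cong: "A u = A v"
    if "u \<in> poly_space X" "v \<in> poly_space X" "AE \<omega> in M. u \<omega> = v \<omega>" for u v
  proof -
    have "\<alpha> n u = \<alpha> n v" for n
      using inner_cong_AE[OF that(1,2) eX eX that(3)] by (simp add: \<alpha>_def)
    then show ?thesis by (simp add: A_def)
  qed
  have e_null: "AE \<omega> in M. e k \<omega> = 0" if "L2_inner M (e k) (e k) = 0" for k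
    using inner_self_zero[OF eX that] .
  have zeroX: "(\<lambda>_. 0) \<in> poly_space X" using poly_space_lincomb[OF eX eX, of 0 0 0 0] by simp
  have chaos_e: "AE \<omega> in M. g \<omega> = \<alpha> k g * e k \<omega>" if g: "g \<in> chaos M X (int k)" for g k
  proof -
    obtain f where f: "g = poly_rv f X" "f = 0 \<or> int (degree f) \<le> int k"
      using chaos_subset[OF g] unfolding poly_space_le_def by blast
    let ?c = "coeff f k" and ?f = "f - monom (coeff f k) k"
    have "coeff ?f i = 0" if "i \<ge> k" for i
      using f(2) that by (cases "i = k") (auto simp: coeff_eq_0)
    then have "?f = 0 \<or> degree ?f < k"
      by (metis leading_coeff_0_iff not_le)
    then have k: "poly_rv ?f X \<in> poly_space_le X (int k - 1)" unfolding poly_space_le_def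
      by (intro CollectI exI[of _ ?f]) auto
    define l where "l = (\<lambda>\<omega>. g \<omega> - ?c * e k \<omega>)"
    have "l = (\<lambda>\<omega>. 1 * poly_rv ?f X \<omega> + ?c * q k \<omega>)"
      by (auto simp: f(1) l_def e_def m_def poly_rv_def algebra_simps poly_monom)
    then have lF: "l \<in> poly_space_le X (int k - 1)" using poly_space_le_lincomb[OF k qF] by (simp only:)
    have "l \<in> chaos M X (int k)" using chaos_lincomb[OF g e, of 1 "-?c"] by (simp add: l_def)
    then have "L2_inner M l l = 0" using lF unfolding chaos_def by blast
    then have l0: "AE \<omega> in M. l \<omega> = 0" using inner_self_zero sub lF by blast
    then have ge: "AE \<omega> in M. g \<omega> = ?c * e k \<omega>" by (simp add: l_def)
    have ce: "(\<lambda>\<omega>. ?c * e k \<omega>) \<in> poly_space X" using poly_space_lincomb[OF eX eX, of ?c k 0 k] by simp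
    have "L2_inner M g (e k) = L2_inner M (\<lambda>\<omega>. ?c * e k \<omega>) (e k)"
      using ge by (intro inner_cong_AE) (auto intro: sub chaos_subset g ce eX)
    then have i: "L2_inner M g (e k) = ?c * L2_inner M (e k) (e k)"
      using inner_lincomb[OF eX eX eX, of ?c k 0 k k] by simp
    show ?thesis
    proof (cases "L2_inner M (e k) (e k) = 0")
      case True
      show ?thesis using ge e_null[OF True] by eventually_elim simp
    next
      case False
      then have "\<alpha> k g = ?c" using i by (simp add: \<alpha>_def)
      then show ?thesis using ge by simp
    qed
  qed
  have proj: "is_orth_proj M (chaos M X (int n - 1)) (\<lambda>\<omega>. complex_of_real (X \<omega>) * g \<omega>) (A g)"
    if g: "g \<in> chaos M X (int n)" for n g
  proof (cases n)
    case 0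
    have "chaos M X (int n - 1) = {\<lambda>_. 0}"
      using 0 by (auto simp: chaos_def poly_space_le_neg L2_inner_def)
    moreover have "A g = (\<lambda>_. 0)" using A_eq[OF chaos_subset[OF g]] 0 by simp
    ultimately show ?thesis by (simp add: is_orth_proj_def L2_inner_def)
  next
    case (Suc k)
    have gX: "g \<in> poly_space X" using g chaos_subset sub by blast
    have zero: "\<alpha> i g = 0" if "i < n" for i
    proof -
      have "e i \<in> poly_space_le X (int n - 1)"
        using that by (intro poly_space_le_mono[OF eF]) simp
      then show ?thesis using g unfolding chaos_def \<alpha>_def by simp
    qed
    have "(\<Sum>i=1..n. \<alpha> i g * \<beta> i * e (i - 1) \<omega>) = (\<Sum>i\<in>{n}. \<alpha> i g * \<beta> i * e (i - 1) \<omega>)" for \<omega>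
      by (rule sum.mono_neutral_right) (use zero Suc in auto)
    then have Ag: "A g = (\<lambda>\<omega>. \<alpha> n g * \<beta> n * e k \<omega>)"
      using A_eq[OF chaos_subset[OF g]] Suc by simp
    have "L2_inner M (\<lambda>\<omega>. complex_of_real (X \<omega>) * g \<omega> - A g \<omega>) h = 0"
      if h: "h \<in> chaos M X (int k)" for h
    proof -
      let ?a = "\<alpha> n g" and ?b = "\<alpha> k h"
      let ?x = "\<lambda>\<omega>. complex_of_real (X \<omega>) * e n \<omega>"
      let ?u = "\<lambda>\<omega>. ?a * ?x \<omega> + (- (?a * \<beta> n)) * e k \<omega>"
      have xX: "?x \<in> poly_space X" using poly_space_mult eX by blast
      have uX: "?u \<in> poly_space X" using poly_space_lincomb[OF xX eX] .
      have bX: "(\<lambda>\<omega>. ?b * e k \<omega>) \<in> poly_space X" using poly_space_lincomb[OF eX eX, of ?b k 0 k] by simp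
      have hX: "h \<in> poly_space X" using h chaos_subset sub by blast
      have lX: "(\<lambda>\<omega>. complex_of_real (X \<omega>) * g \<omega> - A g \<omega>) \<in> poly_space X"
        using poly_space_lincomb[OF poly_space_mult[OF gX] mem[OF gX], of 1 "-1"] by simp
      have "AE \<omega> in M. complex_of_real (X \<omega>) * g \<omega> - A g \<omega> = ?u \<omega>"
        using chaos_e[OF g] by eventually_elim (simp add: Ag)
      then have "L2_inner M (\<lambda>\<omega>. complex_of_real (X \<omega>) * g \<omega> - A g \<omega>) h =
          L2_inner M ?u (\<lambda>\<omega>. ?b * e k \<omega>)"
        using chaos_e[OF h] by (intro inner_cong_AE lX uX hX bX)
      also have "\<dots> = cnj ?b * L2_inner M ?u (e k)"
        unfolding L2_inner_def by (simp add: mult.left_commute flip: integral_mult_right_zero)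
      also have "L2_inner M ?u (e k) = ?a * (L2_inner M ?x (e k) - \<beta> n * L2_inner M (e k) (e k))"
        by (subst inner_lincomb[OF xX eX eX]) (simp add: algebra_simps)
      also have "L2_inner M ?x (e k) - \<beta> n * L2_inner M (e k) (e k) = 0"
      proof (cases "L2_inner M (e k) (e k) = 0")
        case True
        then have "L2_inner M ?x (e k) = L2_inner M ?x (\<lambda>_. 0)"
          using e_null by (intro inner_cong_AE xX eX zeroX) auto
        then show ?thesis using True by (simp add: L2_inner_def)
      next
        case False
        then show ?thesis using Suc by (simp add: \<beta>_def)
      qed
      finally show ?thesis by simp
    qed
    moreover have "A g \<in> chaos M X (int k)"
      using chaos_lincomb[OF e e, of "\<alpha> n g * \<beta> n" k 0]
      by (simp add: Ag)
    ultimately show ?thesis using Suc by (simp add: is_orth_proj_def)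
  qed
  have "is_annihilation_operator M X A"
    unfolding is_annihilation_operator_def
  proof (intro conjI ballI allI impI)
    fix u v :: "'a \<Rightarrow> complex" and z :: complex
    assume u: "u \<in> poly_space X"
    show "A u \<in> poly_space X" by (rule mem[OF u])
    show "AE \<omega> in M. A (\<lambda>x. z * u x) \<omega> = z * A u \<omega>"
      using lin[OF u u, of z 0] by simp
    assume v: "v \<in> poly_space X"
    show "AE \<omega> in M. A (\<lambda>x. u x + v x) \<omega> = A u \<omega> + A v \<omega>"
      using lin[OF u v, of 1 1] by simp
    show "AE \<omega> in M. A u \<omega> = A v \<omega>" if "AE \<omega> in M. u \<omega> = v \<omega>"
      using cong[OF u v that] by simp
  qed (rule proj)
  then show ?thesis by blast
qed

end

end

(*
  For n = 0 the variance of X vanishes.  For n >= 1 no nonzero polynomial vanishes almost surely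
  at X, and the monic orthogonal polynomials P m satisfy T (P (m + 1)) = w m P m and
  (X - T) (P m) = P (m + 1) + a m P m, where T is the given sum of translations.  Its commutator
  with multiplication by X is T' = sum of c i d i times translation by d i.  Since T' commutes
  with T, the recurrence coefficients are affine in m and T' = w 0 + (a 1 - a 0) T on all
  polynomials.  Distinct translations being linearly independent, d i = a 1 - a 0 whenever d i is
  nonzero: there is a single nonzero d j.  Finally, pairing with the constant 1 gives the
  identity E[T f(X)] = E[(X - E X) f(X)], which determines the moments of X as those of
  b + d j Y with Y Poisson; the Poisson distribution is determined by its moments.
*)
theory Submission
  imports Defs
begin

subsection \<open>Sums of translations on polynomials\<close>

definition translation_sum ::
    "nat \<Rightarrow> (nat \<Rightarrow> real) \<Rightarrow> (nat \<Rightarrow> real) \<Rightarrow> complex poly \<Rightarrow> complex poly" where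
  "translation_sum n c d f =
     (\<Sum>i=1..n. smult (complex_of_real (c i)) (pcompose f [:complex_of_real (d i), 1:]))"

lemma poly_translation_sum:
  "poly (translation_sum n c d f) x =
     (\<Sum>i=1..n. complex_of_real (c i) * poly f (x + complex_of_real (d i)))"
  by (simp add: translation_sum_def poly_sum poly_pcompose add.commute)

lemma translation_sum_add:
  "translation_sum n c d (f + g) = translation_sum n c d f + translation_sum n c d g"
  by (simp add: translation_sum_def pcompose_add smult_add_right sum.distrib)

lemma translation_sum_smult:
  "translation_sum n c d (smult a f) = smult a (translation_sum n c d f)"
proof -
  have "poly (translation_sum n c d (smult a f)) x = poly (smult a (translation_sum n c d f)) x" for x
    by (simp add: poly_translation_sum sum_distrib_left mult.left_commute)
  then show ?thesis by (intro poly_eq_poly_eq_iff[THEN iffD1] ext)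
qed

lemma translation_sum_diff:
  "translation_sum n c d (f - g) = translation_sum n c d f - translation_sum n c d g"
  by (simp add: translation_sum_def pcompose_diff smult_diff_right sum_subtractf)

lemma translation_sum_0 [simp]: "translation_sum n c d 0 = 0"
  by (simp add: translation_sum_def)

lemma translation_sum_commute:
  "translation_sum n c d (translation_sum m c' d' f) =
     translation_sum m c' d' (translation_sum n c d f)"
proof -
  have "poly (translation_sum n c d (translation_sum m c' d' f)) x =
      poly (translation_sum m c' d' (translation_sum n c d f)) x" for x
    by (simp add: poly_translation_sum sum_distrib_left) (subst sum.swap, simp add: ac_simps)
  then show ?thesis by (intro poly_eq_poly_eq_iff[THEN iffD1] ext)
qed

text \<open>Translating \<open>x * f x\<close> by \<open>d i\<close> produces the factor
  \<open>x + d i\<close>. The commutator with multiplication by \<open>x\<close> is therefore again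
  a sum of translations, and so it commutes with the original one.\<close>

lemma translation_sum_commutator:
  "translation_sum n (\<lambda>i. c i * d i) d f =
     translation_sum n c d (pCons 0 f) - pCons 0 (translation_sum n c d f)"
proof -
  have "poly (translation_sum n (\<lambda>i. c i * d i) d f) x =
      poly (translation_sum n c d (pCons 0 f) - pCons 0 (translation_sum n c d f)) x" for x
    by (simp add: poly_translation_sum sum_distrib_left sum_subtractf [symmetric] algebra_simps)
  then show ?thesis by (intro poly_eq_poly_eq_iff[THEN iffD1] ext)
qed

text \<open>Phrasing the bound through coefficients gives the zero polynomial degree below every
  \<open>n\<close>, including \<open>n = 0\<close>. This matches the convention that the space of
  index -1 is zero.\<close>

definition deg_less :: "nat \<Rightarrow> 'a::zero poly \<Rightarrow> bool" where
  "deg_less n f \<longleftrightarrow> (\<forall>i\<ge>n. coeff f i = 0)"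

lemma deg_less_iff: "deg_less n f \<longleftrightarrow> f = 0 \<or> degree f < n"
  unfolding deg_less_def by (metis coeff_0 coeff_eq_0 leading_coeff_0_iff not_le order_less_le_trans)

lemma poly_space_le_eq: "poly_space_le X (int n - 1) = (\<lambda>f. poly_rv f X) ` {f. deg_less n f}"
  unfolding poly_space_le_def deg_less_iff by auto

lemma deg_less_diff_monic:
  fixes f p :: "'a::comm_ring_1 poly"
  assumes "deg_less (Suc n) f" "coeff p n = 1" "deg_less (Suc n) p"
  shows "deg_less n (f - smult (coeff f n) p)"
  unfolding deg_less_def
proof (intro allI impI)
  fix i assume "n \<le> i"
  then show "coeff (f - smult (coeff f n) p) i = 0"
    using assms by (cases "i = n") (auto simp: deg_less_def)
qed

text \<open>Subtracting leading terms shows that a sequence with one monic polynomial per degree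
  spans. Linear identities can then be checked on the sequence without writing out basis
  expansions.\<close>

lemma monic_sequence_induct:
  fixes P :: "nat \<Rightarrow> 'a::comm_ring_1 poly"
  assumes P: "\<And>n. coeff (P n) n = 1" "\<And>n. deg_less (Suc n) (P n)"
    and base: "\<And>n. Q (P n)"
    and smult: "\<And>a f. Q f \<Longrightarrow> Q (smult a f)"
    and add: "\<And>f g. Q f \<Longrightarrow> Q g \<Longrightarrow> Q (f + g)"
  shows "Q f"
proof -
  have "Q f" if "deg_less n f" for n
    using that
  proof (induction n arbitrary: f)
    case 0
    then have "f = smult 0 (P 0)" by (simp add: deg_less_iff)
    then show ?case using smult base by metis
  next
    case (Suc n)
    let ?g = "f - smult (coeff f n) (P n)"
    have "deg_less n ?g" by (rule deg_less_diff_monic[OF Suc.prems P])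
    then have "Q (?g + smult (coeff f n) (P n))" using Suc.IH smult base add by blast
    then show ?case by simp
  qed
  moreover have "deg_less (Suc (degree f)) f" by (simp add: deg_less_iff)
  ultimately show ?thesis by blast
qed

subsection \<open>Moments and the Poisson distribution\<close>

lemma power_le_fact_exp:
  fixes x :: real
  assumes "x \<ge> 0"
  shows "x ^ n \<le> fact n * exp x"
proof -
  have "(\<Sum>k\<in>{n}. inverse (fact k) * x ^ k) \<le> (\<Sum>k. inverse (fact k) * x ^ k)"
    using assms summable_exp[of x] by (intro sum_le_suminf) auto
  then show ?thesis
    by (simp add: exp_def scaleR_conv_of_real field_simps)
qed

text \<open>Both characteristic functions share their Taylor polynomials at 0. The remainders are
  bounded by absolute moments, which the exponential moments of \<open>N\<close> make summably small
  for every \<open>t\<close>.\<close>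

lemma moments_determine_distribution:
  fixes M N :: "real measure"
  assumes "real_distribution M" and "real_distribution N"
    and intM: "\<And>k. integrable M (\<lambda>x. x ^ k)" and intN: "\<And>k. integrable N (\<lambda>x. x ^ k)"
    and eq: "\<And>k. (\<integral>x. x ^ k \<partial>M) = (\<integral>x. x ^ k \<partial>N)"
    and exp_int: "\<And>s. s \<ge> 0 \<Longrightarrow> integrable N (\<lambda>x. exp (s * \<bar>x\<bar>))"
  shows "M = N"
proof (rule Levy_uniqueness)
  interpret M: real_distribution M by fact
  interpret N: real_distribution N by fact
  show "char M = char N"
  proof
    fix t
    \<comment> \<open>The factor 2 leaves a spare \<open>2 ^ n\<close>, so the remainder decays like
      \<open>(1/2) ^ n\<close>.\<close>
    define C where "C = (\<integral>x. exp (2 * \<bar>t\<bar> * \<bar>x\<bar>) \<partial>N)"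
    have C: "C \<ge> 0" unfolding C_def by simp
    have moment: "2 * \<bar>t\<bar> ^ n / fact n * (\<integral>x. \<bar>x\<bar> ^ n \<partial>N) \<le> 2 * C * (1/2) ^ n" for n
    proof -
      have "(2 * \<bar>t\<bar>) ^ n * (\<integral>x. \<bar>x\<bar> ^ n \<partial>N) = (\<integral>x. (2 * \<bar>t\<bar> * \<bar>x\<bar>) ^ n \<partial>N)"
        by (simp add: power_mult_distrib)
      also have "\<dots> \<le> (\<integral>x. fact n * exp (2 * \<bar>t\<bar> * \<bar>x\<bar>) \<partial>N)"
      proof (rule integral_mono)
        show "integrable N (\<lambda>x. (2 * \<bar>t\<bar> * \<bar>x\<bar>) ^ n)"
          using integrable_abs[OF intN[of n]] by (simp add: power_mult_distrib power_abs)
        show "integrable N (\<lambda>x. fact n * exp (2 * \<bar>t\<bar> * \<bar>x\<bar>))"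
          using exp_int[of "2 * \<bar>t\<bar>"] by simp
      qed (auto intro: power_le_fact_exp)
      also have "\<dots> = fact n * C" by (simp add: C_def)
      finally have "2 ^ n * (\<bar>t\<bar> ^ n * (\<integral>x. \<bar>x\<bar> ^ n \<partial>N)) \<le> fact n * C"
        by (simp add: power_mult_distrib mult.assoc)
      then show ?thesis by (simp add: field_simps)
    qed
    \<comment> \<open>At even order the absolute moment is an ordinary moment, so the remainder for
      \<open>M\<close> equals a quantity computed under \<open>N\<close>.\<close>
    have "cmod (char M t - char N t) \<le> 4 * C * (1/2) ^ (2 * n)" for n
    proof -
      let ?S = "\<Sum>k\<le>2*n. ((\<i> * t)^k / fact k) * (\<integral>x. x ^ k \<partial>N)"
      have abs: "\<bar>x\<bar> ^ (2 * n) = x ^ (2 * n)" for x :: real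
        by (simp add: power_mult)
      have "cmod (char M t - ?S) \<le> 2 * \<bar>t\<bar> ^ (2*n) / fact (2*n) * (\<integral>x. \<bar>x\<bar> ^ (2*n) \<partial>N)"
        using M.char_approx1[of "2*n" t, OF intM] by (simp add: eq abs)
      moreover have "cmod (char N t - ?S) \<le> 2 * \<bar>t\<bar> ^ (2*n) / fact (2*n) * (\<integral>x. \<bar>x\<bar> ^ (2*n) \<partial>N)"
        using N.char_approx1[of "2*n" t, OF intN] by simp
      ultimately have "cmod ((char M t - ?S) - (char N t - ?S)) \<le> 4 * C * (1/2) ^ (2*n)"
        using norm_triangle_ineq4[of "char M t - ?S" "char N t - ?S"] moment[of "2*n"] by linarith
      then show ?thesis by simp
    qed
    then have bound: "cmod (char M t - char N t) \<le> 4 * C * (1/4) ^ n" for n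
      by (simp add: power_mult power2_eq_square)
    have "(\<lambda>n. 4 * C * (1/4) ^ n) \<longlonglongrightarrow> 0"
      by (intro tendsto_mult_right_zero LIMSEQ_power_zero) simp
    then have "cmod (char M t - char N t) \<le> 0"
      using bound by (intro LIMSEQ_le_const) auto
    then show "char M t = char N t" by simp
  qed
qed fact+

section \<open>The moment recursion characterising the Poisson distribution\<close>

lemma integrable_poisson_exp:
  assumes "l > 0"
  shows "integrable (measure_pmf (poisson_pmf l)) (\<lambda>k. exp (s * real k))"
proof -
  have "summable (\<lambda>k. exp (- l) * (inverse (fact k) * (l * exp s) ^ k))"
    by (intro summable_mult summable_exp)
  also have "(\<lambda>k. exp (- l) * (inverse (fact k) * (l * exp s) ^ k)) =
      (\<lambda>k. pmf (poisson_pmf l) k * exp (s * real k))"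
    using assms by (auto simp: power_mult_distrib exp_of_nat_mult [symmetric] field_simps)
  finally show ?thesis
    by (simp add: measure_pmf_eq_density integrable_density integrable_count_space_nat_iff)
qed

lemma integrable_poisson_power:
  assumes "l > 0"
  shows "integrable (measure_pmf (poisson_pmf l)) (\<lambda>k. real k ^ n)"
proof (rule Bochner_Integration.integrable_bound)
  show "integrable (measure_pmf (poisson_pmf l)) (\<lambda>k. fact n * exp (real k))"
    using integrable_poisson_exp[OF assms, of 1] by simp
  show "AE k in measure_pmf (poisson_pmf l). norm (real k ^ n) \<le> norm (fact n * exp (real k))"
    using power_le_fact_exp[of "real k" n for k] by (intro AE_I2) (simp add: abs_mult)
qed simp

text \<open>The weights satisfy \<open>(k + 1) * p (k + 1) = l * p k\<close>; the identity is a
  shift of the summation index, the term at 0 being zero.\<close>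

lemma poisson_stein:
  fixes g :: "nat \<Rightarrow> real"
  assumes "l > 0" and "integrable (measure_pmf (poisson_pmf l)) (\<lambda>k. g (Suc k))"
  shows "(\<integral>k. real k * g k \<partial>measure_pmf (poisson_pmf l)) =
    l * (\<integral>k. g (Suc k) \<partial>measure_pmf (poisson_pmf l))"
proof -
  let ?p = "\<lambda>k. pmf (poisson_pmf l) k"
  let ?f = "\<lambda>k. ?p k * (real k * g k)"
  have Suc: "?f (Suc k) = l * (?p k * g (Suc k))" for k
  proof -
    have "?p (Suc k) * real (Suc k) = l * ?p k"
      using assms(1) by (simp del: of_nat_Suc)
    then show ?thesis by (metis mult.assoc)
  qed
  have abs: "summable (\<lambda>k. \<bar>?p k * g (Suc k)\<bar>)"
    using assms(2)
    by (simp add: measure_pmf_eq_density integrable_density integrable_count_space_nat_iff)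
  then have "summable (\<lambda>k. \<bar>l\<bar> * \<bar>?p k * g (Suc k)\<bar>)" by (rule summable_mult)
  then have "summable (\<lambda>k. \<bar>?f (Suc k)\<bar>)" unfolding Suc abs_mult .
  then have abs': "summable (\<lambda>k. \<bar>?f k\<bar>)" by (subst (asm) summable_Suc_iff)
  have "(\<Sum>k. ?f k) = (\<Sum>k. ?f (Suc k))"
    using suminf_split_head[OF summable_rabs_cancel[OF abs']] by simp
  also have "\<dots> = l * (\<Sum>k. ?p k * g (Suc k))"
    unfolding Suc by (rule suminf_mult[OF summable_rabs_cancel[OF abs]])
  finally show ?thesis
    using abs abs'
    by (simp add: measure_pmf_eq_density integral_density integral_count_space_nat
        integrable_count_space_nat_iff)
qed

text \<open>By the binomial formula the right side of \<open>rec\<close> involves only moments of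
  order at most \<open>k\<close>, so all moments follow from the total mass. The Poisson moments
  obey the same recursion, by \<open>poisson_stein\<close> for powers.\<close>

lemma (in prob_space) poisson_if_moment_recursion:
  assumes [measurable]: "Z \<in> borel_measurable M" and l: "l > 0"
    and int: "\<And>k. integrable M (\<lambda>\<omega>. Z \<omega> ^ k)"
    and rec: "\<And>k. expectation (\<lambda>\<omega>. Z \<omega> ^ Suc k) = l * expectation (\<lambda>\<omega>. (Z \<omega> + 1) ^ k)"
  shows "distr M borel Z = distr (measure_pmf (poisson_pmf l)) borel real"
proof (rule moments_determine_distribution)
  let ?P = "measure_pmf (poisson_pmf l)"
  show "real_distribution (distr M borel Z)"
    by (rule real_distribution_distr) simp
  show "real_distribution (distr ?P borel real)"
    by (rule prob_space.real_distribution_distr[OF measure_pmf.prob_space_axioms]) simp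
  show "integrable (distr M borel Z) (\<lambda>x. x ^ k)" for k
    using int by (simp add: integrable_distr_eq)
  show "integrable (distr ?P borel real) (\<lambda>x. x ^ k)" for k
    using integrable_poisson_power[OF l] by (simp add: integrable_distr_eq)
  show "integrable (distr ?P borel real) (\<lambda>x. exp (s * \<bar>x\<bar>))" for s
    using integrable_poisson_exp[OF l] by (simp add: integrable_distr_eq)
  have expand: "(\<integral>x. (h x + 1) ^ k \<partial>Q) = (\<Sum>i\<le>k. real (k choose i) * (\<integral>x. h x ^ i \<partial>Q))"
    if "\<And>k. integrable Q (\<lambda>x. h x ^ k)" for k and h :: "'b \<Rightarrow> real" and Q
    using that by (simp add: binomial_ring)
  have "expectation (\<lambda>\<omega>. Z \<omega> ^ k) = (\<integral>j. real j ^ k \<partial>?P)" for k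
  proof (induction k rule: less_induct)
    case (less k)
    show ?case
    proof (cases k)
      case 0
      then show ?thesis using prob_space by simp
    next
      case (Suc m)
      have intS: "integrable ?P (\<lambda>j. real (Suc j) ^ m)"
        using integrable_poisson_power[OF l]
        by (simp add: binomial_ring add.commute[of 1] del: of_nat_Suc add: of_nat_Suc)
      have "(\<integral>j. real j ^ k \<partial>?P) = l * (\<integral>j. (real j + 1) ^ m \<partial>?P)"
        using poisson_stein[OF l intS] by (simp add: Suc add.commute)
      then show ?thesis
        using less Suc rec[of m] by (simp add: expand int integrable_poisson_power[OF l])
    qed
  qed
  then show "(\<integral>x. x ^ k \<partial>distr M borel Z) = (\<integral>x. x ^ k \<partial>distr ?P borel real)" for k
    by (simp add: integral_distr)
qed

subsection \<open>Orthogonal polynomials and the annihilation operator\<close>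

locale translation_annihilation = prob_space M
  for M :: "'a measure" +
  fixes X :: "'a \<Rightarrow> real" and A :: "('a \<Rightarrow> complex) \<Rightarrow> 'a \<Rightarrow> complex"
    and n :: nat and c d :: "nat \<Rightarrow> real"
  assumes meas [measurable]: "X \<in> borel_measurable M"
    and mom: "finite_moments M X"
    and annih: "is_annihilation_operator M X A"
    and c_nonzero: "\<And>i. i \<in> {1..n} \<Longrightarrow> c i \<noteq> 0"
    and c_sum: "(\<Sum>i=1..n. c i) = 0"
    and d_inj: "inj_on d {1..n}"
    and A_translations: "\<And>f :: complex poly. AE \<omega> in M.
           A (poly_rv f X) \<omega> =
             (\<Sum>i=1..n. complex_of_real (c i) * translate_rv (complex_of_real (d i)) f X \<omega>)"
begin

abbreviation rv :: "complex poly \<Rightarrow> 'a \<Rightarrow> complex" where "rv f \<equiv> poly_rv f X"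

abbreviation T :: "complex poly \<Rightarrow> complex poly" where "T \<equiv> translation_sum n c d"

text \<open>A Hermitian form that is a priori only semidefinite: it degenerates when
  \<open>X\<close> takes finitely many values. Definiteness for \<open>n \<ge> 1\<close> is
  \<open>ip_self_eq_0\<close>.\<close>

definition ip :: "complex poly \<Rightarrow> complex poly \<Rightarrow> complex" where
  "ip f g = L2_inner M (rv f) (rv g)"

lemma rv_in_poly_space [simp, intro]: "rv f \<in> poly_space X"
  unfolding poly_space_def by blast

lemma A_rv: "AE \<omega> in M. A (rv f) \<omega> = rv (T f) \<omega>"
  using A_translations[of f] by (simp add: poly_rv_def translate_rv_def poly_translation_sum)

lemma A_in_poly_space: "A (rv f) \<in> poly_space X"
  using annih unfolding is_annihilation_operator_def by blast

lemma ip_lincomb: "ip (smult a f + smult b g) h = a * ip f h + b * ip g h"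
  using inner_lincomb[OF meas mom rv_in_poly_space rv_in_poly_space rv_in_poly_space, of a f b g h]
  by (simp add: ip_def poly_rv_def)

lemma ip_add: "ip (f + g) h = ip f h + ip g h"
  using ip_lincomb[of 1 f 1 g h] by simp

lemma ip_diff: "ip (f - g) h = ip f h - ip g h"
  using ip_lincomb[of 1 f "-1" g h] by simp

lemma ip_smult: "ip (smult a f) h = a * ip f h"
  using ip_lincomb[of a f 0 f h] by simp

lemma ip_cnj: "ip g f = cnj (ip f g)"
  unfolding ip_def by (rule inner_cnj[OF meas mom])

lemma ip_add_right: "ip h (f + g) = ip h f + ip h g"
  by (metis ip_add ip_cnj complex_cnj_add)

lemma ip_smult_right: "ip h (smult a f) = cnj a * ip h f"
  by (metis ip_smult ip_cnj complex_cnj_mult)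

lemma ip_zero [simp]: "ip 0 f = 0" "ip f 0 = 0"
  by (simp_all add: ip_def poly_rv_def L2_inner_def)

text \<open>Multiplication by \<open>X\<close> is symmetric because \<open>X\<close> is
  real-valued.\<close>

lemma ip_mult_X: "ip (pCons 0 f) g = ip f (pCons 0 g)"
  by (simp add: ip_def poly_rv_def L2_inner_def ac_simps)

lemma ip_1: "ip f 1 = (\<integral>\<omega>. rv f \<omega> \<partial>M)"
  by (simp add: ip_def poly_rv_def L2_inner_def)

lemma rv_eq_0_if_ip_self_0: "ip f f = 0 \<Longrightarrow> AE \<omega> in M. rv f \<omega> = 0"
  unfolding ip_def using inner_self_zero[OF meas mom] by blast

lemma L2_inner_A: "L2_inner M (A (rv f)) (rv h) = ip (T f) h"
  unfolding ip_def by (rule inner_cong_AE[OF meas mom]) (auto simp: A_in_poly_space A_rv)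

text \<open>The monic orthogonal polynomials. They are chosen by \<open>SOME\<close> since a
  semidefinite form may admit several candidates; one is \<open>x ^ m\<close> minus its projection
  to lower degrees.\<close>

definition P :: "nat \<Rightarrow> complex poly" where
  "P m = (SOME p. coeff p m = 1 \<and> deg_less (Suc m) p \<and> (\<forall>h. deg_less m h \<longrightarrow> ip p h = 0))"

lemma P_props: "coeff (P m) m = 1 \<and> deg_less (Suc m) (P m) \<and> (\<forall>h. deg_less m h \<longrightarrow> ip (P m) h = 0)"
  unfolding P_def
proof (rule someI_ex)
  obtain u where "is_orth_proj M (poly_space_le X (int m - 1)) (rv (monom 1 m)) u"
    using proj_exists[OF meas mom] by blast
  then obtain q where q: "deg_less m q"
    "\<And>h. deg_less m h \<Longrightarrow> L2_inner M (\<lambda>\<omega>. rv (monom 1 m) \<omega> - rv q \<omega>) (rv h) = 0"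
    unfolding is_orth_proj_def poly_space_le_eq by blast
  have "(\<lambda>\<omega>. rv (monom 1 m) \<omega> - rv q \<omega>) = rv (monom 1 m - q)"
    by (simp add: poly_rv_def)
  then have "\<forall>h. deg_less m h \<longrightarrow> ip (monom 1 m - q) h = 0"
    using q(2) by (simp add: ip_def)
  then show "\<exists>p. coeff p m = 1 \<and> deg_less (Suc m) p \<and> (\<forall>h. deg_less m h \<longrightarrow> ip p h = 0)"
    using q(1) by (intro exI[of _ "monom 1 m - q"]) (auto simp: deg_less_def)
qed

lemma coeff_P: "coeff (P m) m = 1" and deg_P: "deg_less (Suc m) (P m)"
  and ip_P: "deg_less m h \<Longrightarrow> ip (P m) h = 0"
  using P_props by auto

lemma P_induct:
  assumes "\<And>m. Q (P m)" "\<And>a f. Q f \<Longrightarrow> Q (smult a f)" "\<And>f g. Q f \<Longrightarrow> Q g \<Longrightarrow> Q (f + g)"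
  shows "Q f"
  by (rule monic_sequence_induct[of P]) (use coeff_P deg_P assms in blast)+

lemma P_0: "P 0 = 1"
  using coeff_P[of 0] deg_P[of 0]
  by (intro poly_eqI) (auto simp: deg_less_def coeff_1 Suc_le_eq)

lemma P_nonzero: "P m \<noteq> 0"
  using coeff_P[of m] by auto

lemma deg_less_diff_P: "deg_less (Suc m) f \<Longrightarrow> deg_less m (f - smult (coeff f m) (P m))"
  by (rule deg_less_diff_monic[OF _ coeff_P deg_P])

lemma rv_P_in_chaos: "rv (P m) \<in> chaos M X (int m)"
proof -
  have "rv (P m) \<in> poly_space_le X (int m)"
    using poly_space_le_eq[of X "Suc m"] deg_P by auto
  then show ?thesis
    using ip_P unfolding chaos_def poly_space_le_eq ip_def by auto
qed

lemma A_P_proj: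
  "is_orth_proj M (chaos M X (int m - 1)) (\<lambda>\<omega>. complex_of_real (X \<omega>) * rv (P m) \<omega>) (A (rv (P m)))"
  using annih rv_P_in_chaos unfolding is_annihilation_operator_def by blast

lemma A_P_in_chaos: "A (rv (P m)) \<in> chaos M X (int m - 1)"
  using A_P_proj unfolding is_orth_proj_def by blast

lemma ip_T_P:
  assumes "deg_less m h"
  shows "ip (T (P (Suc m))) h = 0"
proof -
  have "rv h \<in> poly_space_le X (int m - 1)"
    using assms unfolding poly_space_le_eq by blast
  then have "L2_inner M (A (rv (P (Suc m)))) (rv h) = 0"
    using A_P_in_chaos[of "Suc m"] unfolding chaos_def by simp
  then show ?thesis by (simp only: L2_inner_A)
qed

text \<open>Removing the annihilation part from multiplication by \<open>X\<close> leaves nothing of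
  degree below \<open>m\<close>. For \<open>m = k + 1\<close>, \<open>h\<close> splits into a part
  of degree below \<open>k\<close>, orthogonal to both terms, and a multiple of \<open>P k\<close>,
  where the projection property of \<open>A\<close> applies.\<close>

lemma ip_X_minus_T_P:
  assumes "deg_less m h"
  shows "ip (pCons 0 (P m) - T (P m)) h = 0"
proof (cases m)
  case 0
  then show ?thesis using assms by (simp add: deg_less_iff)
next
  case (Suc k)
  define r where "r = h - smult (coeff h k) (P k)"
  have r: "deg_less k r" unfolding r_def using assms Suc deg_less_diff_P by simp
  have "deg_less m (pCons 0 r)"
    using r Suc by (auto simp: deg_less_def coeff_pCons split: nat.splits)
  then have "ip (pCons 0 (P m) - T (P m)) r = 0"
    using ip_T_P[OF r] ip_P[of m "pCons 0 r"] Suc by (simp add: ip_diff ip_mult_X)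
  moreover have "ip (pCons 0 (P m) - T (P m)) (P k) = 0"
  proof -
    have X: "(\<lambda>\<omega>. complex_of_real (X \<omega>) * rv (P m) \<omega>) = rv (pCons 0 (P m))"
      by (simp add: poly_rv_def)
    have "L2_inner M (\<lambda>\<omega>. rv (pCons 0 (P m)) \<omega> - A (rv (P m)) \<omega>) (rv (P k)) = 0"
      using A_P_proj[of m] rv_P_in_chaos[of k] Suc unfolding is_orth_proj_def X by simp
    then show ?thesis
      using inner_diff[OF meas mom rv_in_poly_space A_in_poly_space rv_in_poly_space]
      by (simp add: L2_inner_A ip_diff flip: ip_def)
  qed
  moreover have "h = r + smult (coeff h k) (P k)" by (simp add: r_def)
  ultimately show ?thesis by (metis ip_add_right ip_smult_right mult_zero_right add_0)
qed

text \<open>This is orthogonality to the constant 1. For \<open>P m\<close> with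
  \<open>m > 0\<close> it is \<open>ip_X_minus_T_P\<close> at \<open>h = 1\<close>; for
  \<open>P 0\<close> both sides vanish, by \<open>c_sum\<close> and by centring.\<close>

lemma stein_identity:
  "(\<integral>\<omega>. rv (T f) \<omega> \<partial>M) = (\<integral>\<omega>. rv ([:- complex_of_real (expectation X), 1:] * f) \<omega> \<partial>M)"
proof -
  let ?L = "[:- complex_of_real (expectation X), 1:]"
  have "ip (T f) 1 = ip (?L * f) 1"
  proof (induction f rule: P_induct)
    case (1 m)
    show ?case
    proof (cases m)
      case 0
      have "T 1 = 0"
      proof -
        have "poly (T 1) x = poly 0 x" for x
          using c_sum by (simp add: poly_translation_sum flip: of_real_sum)
        then show ?thesis by (intro poly_eq_poly_eq_iff[THEN iffD1] ext)
      qed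
      moreover have "ip ?L 1 = 0"
      proof -
        have "integrable M X" using mom[unfolded finite_moments_def, rule_format, of 1] by simp
        then show ?thesis by (simp add: ip_1 poly_rv_def prob_space)
      qed
      ultimately show ?thesis using 0 P_0 by simp
    next
      case (Suc k)
      have "deg_less m (1 :: complex poly)" using Suc by (simp add: deg_less_def coeff_1)
      then have "ip (pCons 0 (P m) - T (P m)) 1 = 0" "ip (P m) 1 = 0"
        using ip_X_minus_T_P ip_P by auto
      moreover have "?L * P m = smult (- complex_of_real (expectation X)) (P m) + pCons 0 (P m)"
        by simp
      ultimately show ?thesis by (simp add: ip_diff ip_add ip_smult del: mult_pCons_left)
    qed
  qed (simp_all add: translation_sum_smult translation_sum_add ip_smult ip_add distrib_left
      del: mult_pCons_left)
  then show ?thesis by (simp add: ip_1)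
qed

end

subsection \<open>Uniqueness of the nonzero translation\<close>

lemma shift_leaves_finite_set:
  fixes S :: "real set"
  assumes "finite S" "S \<noteq> {}" "t \<noteq> 0"
  obtains s where "s \<in> S" "s + t \<notin> S"
proof (cases "t > 0")
  case True
  then have "Max S + t \<notin> S" using assms Max_ge[of S "Max S + t"] by auto
  then show ?thesis using that Max_in assms by blast
next
  case False
  then have "Min S + t \<notin> S" using assms Min_le[of S "Min S + t"] by auto
  then show ?thesis using that Min_in assms by blast
qed

lemma poly_vanishing_except:
  fixes S :: "'a::field set"
  assumes "finite S"
  obtains f where "\<And>y. poly f y = 0 \<longleftrightarrow> y \<in> S"
proof
  show "poly (\<Prod>a\<in>S. [:- a, 1:]) y = 0 \<longleftrightarrow> y \<in> S" for y
    using assms by (simp add: poly_prod)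
qed

section \<open>Nondegeneracy of the inner product for \<open>n \<ge> 1\<close>\<close>

context translation_annihilation
begin

lemma d_inj_iff: "i \<in> {1..n} \<Longrightarrow> j \<in> {1..n} \<Longrightarrow> d i = d j \<longleftrightarrow> i = j"
  using d_inj by (auto dest: inj_onD)

text \<open>If all \<open>d i\<close> were 0, distinctness would force \<open>n = 1\<close>, and
  then \<open>c_sum\<close> would give \<open>c 1 = 0\<close>.\<close>

lemma nonzero_translation_exists:
  assumes "n \<ge> 1"
  obtains k where "k \<in> {1..n}" "d k \<noteq> 0"
proof (cases "\<exists>k\<in>{1..n}. d k \<noteq> 0")
  case False
  then have "d 1 = d n" using assms by simp
  then have "n = 1" using assms d_inj_iff[of 1 n] by simp
  then show ?thesis using c_sum c_nonzero[of 1] by simp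
qed (use that in blast)

text \<open>\<open>A\<close> respects almost sure equality, so \<open>T\<close> must as well. This
  is what excludes finite support.\<close>

lemma T_preserves_null:
  assumes "AE \<omega> in M. rv f \<omega> = 0"
  shows "AE \<omega> in M. rv (T f) \<omega> = 0"
proof -
  have "AE \<omega> in M. rv f \<omega> = rv 0 \<omega>" using assms by (simp add: poly_rv_def)
  then have "AE \<omega> in M. A (rv f) \<omega> = A (rv 0) \<omega>"
    using annih rv_in_poly_space unfolding is_annihilation_operator_def by blast
  moreover have "AE \<omega> in M. A (rv 0) \<omega> = 0" using A_rv[of 0] by (simp add: poly_rv_def)
  ultimately show ?thesis using A_rv[of f] by eventually_elim simp
qed

text \<open>
  If \<open>X\<close> had finite support \<open>S\<close>, then \<open>T g\<close> would vanish on \<open>S\<close> whenever \<open>g\<close> does. This fails for a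
  \<open>g\<close> vanishing on \<open>S\<close> and at all translates of a point of \<open>S\<close> but one that lies outside \<open>S\<close>.
\<close>
lemma rv_eq_0_imp_poly_eq_0:
  assumes "n \<ge> 1" and null: "AE \<omega> in M. rv f \<omega> = 0"
  shows "f = 0"
proof (rule ccontr)
  assume "f \<noteq> 0"
  \<comment> \<open>\<open>S\<close> keeps the roots of \<open>f\<close> that are atoms of
    \<open>X\<close>; the finitely many other roots are hit with probability 0.\<close>
  define S where "S = {x. poly f (complex_of_real x) = 0 \<and> \<not> (AE \<omega> in M. X \<omega> \<noteq> x)}"
  define R where "R = {x. poly f (complex_of_real x) = 0}"
  have "finite (complex_of_real ` R)"
    by (rule finite_subset[OF _ poly_roots_finite[OF \<open>f \<noteq> 0\<close>]]) (auto simp: R_def)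
  then have R: "finite R" by (rule finite_imageD) (simp add: inj_on_def)
  then have S: "finite S" by (rule rev_finite_subset) (auto simp: S_def R_def)
  have "AE \<omega> in M. \<forall>x\<in>R - S. X \<omega> \<noteq> x"
    using R by (intro AE_finite_allI) (auto simp: S_def R_def)
  then have XS: "AE \<omega> in M. X \<omega> \<in> S"
    using null by eventually_elim (auto simp: R_def poly_rv_def)
  have vanish_on_S: "poly g (complex_of_real s) = 0" if "AE \<omega> in M. rv g \<omega> = 0" "s \<in> S" for g s
  proof (rule ccontr)
    assume ne: "poly g (complex_of_real s) \<noteq> 0"
    have "AE \<omega> in M. X \<omega> \<noteq> s"
      using that(1) by eventually_elim (use ne in \<open>auto simp: poly_rv_def\<close>)
    then show False using that(2) by (simp add: S_def)
  qed
  have "S \<noteq> {}"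
  proof
    assume "S = {}"
    then have "AE \<omega> in M. False" using XS by simp
    then show False by simp
  qed
  obtain k where k: "k \<in> {1..n}" "d k \<noteq> 0" using nonzero_translation_exists[OF assms(1)] .
  obtain s where s: "s \<in> S" "s + d k \<notin> S"
    using shift_leaves_finite_set[OF S \<open>S \<noteq> {}\<close> k(2)] .
  \<comment> \<open>With \<open>g\<close> vanishing exactly on this set, only the
    \<open>k\<close>-th term of \<open>T g\<close> survives at \<open>s\<close>.\<close>
  let ?B = "S \<union> (\<lambda>i. s + d i) ` ({1..n} - {k})"
  have "finite (complex_of_real ` ?B)" using S by simp
  then obtain g where g: "\<And>y. poly g y = 0 \<longleftrightarrow> y \<in> complex_of_real ` ?B"
    using poly_vanishing_except by blast
  have gr: "poly g (complex_of_real y) = 0 \<longleftrightarrow> y \<in> ?B" for y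
    unfolding g by (rule inj_image_mem_iff) (simp add: inj_on_def)
  have "AE \<omega> in M. rv g \<omega> = 0"
    using XS by eventually_elim (simp add: poly_rv_def gr)
  then have "poly (T g) (complex_of_real s) = 0"
    using T_preserves_null vanish_on_S s(1) by blast
  also have "poly (T g) (complex_of_real s) =
      (\<Sum>i=1..n. complex_of_real (c i) * poly g (complex_of_real (s + d i)))"
    by (simp add: poly_translation_sum)
  also have "\<dots> = (\<Sum>i\<in>{k}. complex_of_real (c i) * poly g (complex_of_real (s + d i)))"
    by (rule sum.mono_neutral_right) (use k gr in \<open>auto simp del: of_real_add\<close>)
  finally have "poly g (complex_of_real (s + d k)) = 0"
    using c_nonzero[OF k(1)] by simp
  then have "s + d k \<in> ?B" using gr by blast
  then have "\<exists>i\<in>{1..n} - {k}. s + d k = s + d i" using s(2) by blast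
  then obtain i where "i \<in> {1..n} - {k}" "d k = d i" by (metis add_left_cancel)
  then show False using d_inj_iff[OF k(1), of i] by blast
qed

lemma ip_self_eq_0: "n \<ge> 1 \<Longrightarrow> ip f f = 0 \<Longrightarrow> f = 0"
  using rv_eq_0_imp_poly_eq_0 rv_eq_0_if_ip_self_0 by blast

lemma deg_T_P:
  assumes "n \<ge> 1"
  shows "deg_less m (T (P m))"
proof -
  have "A (rv (P m)) \<in> poly_space_le X (int m - 1)"
    using A_P_in_chaos unfolding chaos_def by blast
  then obtain g where g: "deg_less m g" "A (rv (P m)) = rv g"
    unfolding poly_space_le_eq by blast
  have "AE \<omega> in M. rv (T (P m) - g) \<omega> = 0"
    using A_rv[of "P m"] unfolding g(2) by eventually_elim (simp add: poly_rv_def)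
  then have "T (P m) = g" using rv_eq_0_imp_poly_eq_0[OF assms] by fastforce
  then show ?thesis using g(1) by simp
qed

section \<open>The three-term recurrence and the commutator of \<open>T\<close> with multiplication
  by \<open>X\<close>\<close>

definition w :: "nat \<Rightarrow> complex" where "w m = coeff (T (P (Suc m))) m"

text \<open>The preservation and creation parts of multiplication by \<open>X\<close>. The numbers
  \<open>a m\<close> and \<open>w m\<close> are the Jacobi coefficients of \<open>X\<close>.\<close>

definition R :: "complex poly \<Rightarrow> complex poly" where "R f = pCons 0 f - T f"

definition a :: "nat \<Rightarrow> complex" where "a m = coeff (R (P m) - P (Suc m)) m"

lemma T_P_0: "n \<ge> 1 \<Longrightarrow> T (P 0) = 0"
  using deg_T_P[of 0] by (simp add: deg_less_iff)

text \<open>The difference \<open>r\<close> of the two sides has degree below \<open>m\<close> and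
  is orthogonal to all such polynomials, itself included; definiteness gives \<open>r = 0\<close>.
  \<open>R_P\<close> uses the same argument.\<close>

lemma T_P_Suc:
  assumes "n \<ge> 1"
  shows "T (P (Suc m)) = smult (w m) (P m)"
proof -
  define r where "r = T (P (Suc m)) - smult (w m) (P m)"
  have r: "deg_less m r" unfolding r_def w_def by (rule deg_less_diff_P[OF deg_T_P[OF assms]])
  then have "ip r r = ip (T (P (Suc m))) r - w m * ip (P m) r"
    by (subst r_def) (simp add: ip_diff ip_smult)
  then have "ip r r = 0" using ip_T_P[OF r] ip_P[OF r] by simp
  then have "r = 0" by (rule ip_self_eq_0[OF assms])
  then show ?thesis by (simp add: r_def)
qed

lemma R_P:
  assumes "n \<ge> 1"
  shows "R (P m) = P (Suc m) + smult (a m) (P m)"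
proof -
  define r where "r = R (P m) - P (Suc m) - smult (a m) (P m)"
  have "coeff (R (P m) - P (Suc m)) i = 0" if "i > m" for i
    using that deg_T_P[OF assms, of m] deg_P[of m] deg_P[of "Suc m"] coeff_P[of m] coeff_P[of "Suc m"]
    by (cases i; cases "i = Suc m") (auto simp: R_def deg_less_def)
  then have "deg_less (Suc m) (R (P m) - P (Suc m))" by (auto simp: deg_less_def)
  then have r: "deg_less m r" unfolding r_def a_def by (rule deg_less_diff_P)
  then have r': "deg_less (Suc m) r" by (simp add: deg_less_def)
  have "ip r r = ip (R (P m)) r - ip (P (Suc m)) r - a m * ip (P m) r"
    by (subst r_def) (simp add: ip_diff ip_smult)
  then have "ip r r = 0" using ip_X_minus_T_P[OF r] ip_P[OF r] ip_P[OF r'] by (simp add: R_def)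
  then have "r = 0" by (rule ip_self_eq_0[OF assms])
  then show ?thesis by (simp add: r_def algebra_simps)
qed

text \<open>Pairing \<open>X * P m\<close> with \<open>P (Suc m)\<close> in two ways shows that
  \<open>w m\<close> is the ratio of the squared norms of \<open>P (Suc m)\<close> and
  \<open>P m\<close>.\<close>

lemma w_nonzero:
  assumes "n \<ge> 1"
  shows "w m \<noteq> 0"
proof
  assume "w m = 0"
  then have "ip (pCons 0 (P (Suc m)) - 0) (P m) = 0"
    using ip_X_minus_T_P[OF deg_P, of m] T_P_Suc[OF assms, of m] by simp
  then have "ip (P (Suc m)) (pCons 0 (P m)) = 0" by (simp add: ip_mult_X)
  moreover have "pCons 0 (P m) = P (Suc m) + smult (a m) (P m) + T (P m)"
    using R_P[OF assms, of m] by (simp add: R_def algebra_simps)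
  moreover have "ip (P (Suc m)) (smult (a m) (P m)) = 0" "ip (P (Suc m)) (T (P m)) = 0"
    using ip_P[OF deg_P, of m] ip_P[of "Suc m" "T (P m)"] deg_T_P[OF assms, of m]
    by (auto simp: ip_smult_right deg_less_def)
  ultimately have "ip (P (Suc m)) (P (Suc m)) = 0" by (simp add: ip_add_right)
  then show False using ip_self_eq_0[OF assms] P_nonzero by blast
qed

abbreviation T' :: "complex poly \<Rightarrow> complex poly" where
  "T' \<equiv> translation_sum n (\<lambda>i. c i * d i) d"

text \<open>\<open>R\<close> and multiplication by \<open>X\<close> differ by \<open>T\<close>, so
  they have the same commutator with \<open>T\<close>. The action of \<open>R\<close> on the
  \<open>P m\<close> is explicit.\<close>

lemma T'_eq: "T' f = T (R f) - R (T f)"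
  by (simp add: translation_sum_commutator R_def translation_sum_diff)

lemma R_smult: "R (smult z f) = smult z (R f)"
  by (simp add: R_def translation_sum_smult smult_diff_right)

lemma T'_P_0: "n \<ge> 1 \<Longrightarrow> T' (P 0) = smult (w 0) (P 0)"
  using T_P_Suc[of 0] T_P_0
  by (simp add: T'_eq R_P translation_sum_add translation_sum_smult) (simp add: R_def)

lemma T'_P_Suc:
  assumes "n \<ge> 1"
  shows "T' (P (Suc m)) =
    smult (w (Suc m) - w m) (P (Suc m)) + smult ((a (Suc m) - a m) * w m) (P m)"
proof -
  have eq: "T' (P (Suc m)) = smult (w (Suc m)) (P (Suc m)) + smult (a (Suc m)) (smult (w m) (P m)) -
      smult (w m) (P (Suc m) + smult (a m) (P m))"
    by (simp only: T'_eq R_P[OF assms] T_P_Suc[OF assms] R_smult translation_sum_add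
        translation_sum_smult)
  show ?thesis unfolding eq by (intro poly_eqI) (simp add: algebra_simps)
qed

lemma P_lincomb_eq_0:
  assumes "smult x (P (Suc m)) + smult y (P m) = 0"
  shows "x = 0" "y = 0"
proof -
  have "coeff (smult x (P (Suc m)) + smult y (P m)) (Suc m) = 0" using assms by simp
  then show x: "x = 0" using coeff_P[of "Suc m"] deg_P[of m] by (simp add: deg_less_def)
  show "y = 0" using assms P_nonzero[of m] x by simp
qed

text \<open>Comparing \<open>T (T' p)\<close> with \<open>T' (T p)\<close> for
  \<open>p = P (m + 2)\<close> yields the second differences of \<open>w\<close> and
  \<open>a\<close>, multiplied by nonzero products of values of \<open>w\<close>. The case
  \<open>p = P 1\<close> fixes the first increment of \<open>w\<close>.\<close>

lemma recurrence_coeffs_affine: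
  assumes "n \<ge> 1"
  shows "w (Suc m) - w m = w 0"
    and "a (Suc m) - a m = a 1 - a 0"
proof -
  have w1: "w (Suc 0) - w 0 = w 0"
  proof -
    have "T (T' (P (Suc 0))) = T' (T (P (Suc 0)))" by (rule translation_sum_commute)
    then have "smult (w (Suc 0) - w 0) (smult (w 0) (P 0)) = smult (w 0) (smult (w 0) (P 0))"
      by (simp only: T'_P_Suc[OF assms] T'_P_0[OF assms] T_P_Suc[OF assms] T_P_0[OF assms]
          translation_sum_smult translation_sum_add smult_0_right add_0_right)
    then have "(w (Suc 0) - w 0) * w 0 = w 0 * w 0"
      by (simp add: P_0)
    then show ?thesis using w_nonzero[OF assms, of 0] by simp
  qed
  have step: "w (Suc (Suc m)) - w (Suc m) = w (Suc m) - w m \<and>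
      a (Suc (Suc m)) - a (Suc m) = a (Suc m) - a m" for m
  proof -
    let ?x = "(w (Suc (Suc m)) - w (Suc m)) - (w (Suc m) - w m)"
    let ?y = "(a (Suc (Suc m)) - a (Suc m)) - (a (Suc m) - a m)"
    have "T (T' (P (Suc (Suc m)))) - T' (T (P (Suc (Suc m)))) = 0"
      by (rule iffD2[OF right_minus_eq translation_sum_commute])
    also have "T (T' (P (Suc (Suc m)))) - T' (T (P (Suc (Suc m)))) =
       smult (w (Suc m) * ?x) (P (Suc m)) + smult (w (Suc m) * w m * ?y) (P m)"
      by (simp only: T'_P_Suc[OF assms] T_P_Suc[OF assms] translation_sum_smult translation_sum_add)
         (intro poly_eqI, simp add: algebra_simps)
    finally have "w (Suc m) * ?x = 0" "w (Suc m) * w m * ?y = 0"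
      by (rule P_lincomb_eq_0)+
    then have "?x = 0" "?y = 0"
      using w_nonzero[OF assms, of m] w_nonzero[OF assms, of "Suc m"] unfolding mult_eq_0_iff
      by blast+
    then show ?thesis by (intro conjI) (rule iffD1[OF right_minus_eq], assumption)+
  qed
  show "w (Suc m) - w m = w 0" by (induction m) (simp_all only: w1 step)
  show "a (Suc m) - a m = a 1 - a 0" by (induction m) (simp_all only: One_nat_def step)
qed

text \<open>With constant increments, the formula for \<open>T' (P (Suc m))\<close> has diagonal
  part \<open>w 0\<close> and lower part \<open>a 1 - a 0\<close> times \<open>T\<close>. Both sides
  are linear, so the \<open>P m\<close> suffice.\<close>

lemma T'_relation:
  assumes "n \<ge> 1"
  shows "T' f = smult (w 0) f + smult (a 1 - a 0) (T f)"
proof (induction f rule: P_induct)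
  case (1 m)
  show ?case
  proof (cases m)
    case 0
    then show ?thesis by (simp add: T'_P_0[OF assms] T_P_0[OF assms])
  next
    case (Suc k)
    then show ?thesis
      using recurrence_coeffs_affine[OF assms, of k]
      by (simp add: T'_P_Suc[OF assms] T_P_Suc[OF assms])
  qed
qed (simp_all add: translation_sum_smult translation_sum_add smult_add_right mult.commute)

lemma nonzero_translation_unique:
  assumes "j \<in> {1..n}" "d j \<noteq> 0" "k \<in> {1..n}" "d k \<noteq> 0"
  shows "j = k"
proof -
  have "complex_of_real (d j) = a 1 - a 0" if j: "j \<in> {1..n}" "d j \<noteq> 0" for j
  proof -
    have n: "n \<ge> 1" using j by simp
    \<comment> \<open>Vanishing on this set isolates the \<open>j\<close>-th translation at the
      point 0. Inserting 0 also removes the \<open>w 0\<close> term of \<open>T'_relation\<close>,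
      leaving \<open>c j * d j = (a 1 - a 0) * c j\<close>.\<close>
    let ?B = "insert 0 (d ` ({1..n} - {j}))"
    have "finite (complex_of_real ` ?B)" by simp
    then obtain g where g: "\<And>y. poly g y = 0 \<longleftrightarrow> y \<in> complex_of_real ` ?B"
      using poly_vanishing_except by blast
    have gr: "poly g (complex_of_real y) = 0 \<longleftrightarrow> y \<in> ?B" for y
      unfolding g by (rule inj_image_mem_iff) (simp add: inj_on_def)
    have gj: "poly g (complex_of_real (d j)) \<noteq> 0"
    proof
      assume "poly g (complex_of_real (d j)) = 0"
      then have "d j \<in> ?B" unfolding gr .
      then obtain i where "i \<in> {1..n} - {j}" "d j = d i" using j(2) by blast
      then show False using d_inj_iff[OF j(1), of i] by blast
    qed
    have only_j: "poly (translation_sum n e d g) 0 = complex_of_real (e j) * poly g (complex_of_real (d j))" for e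
    proof -
      have "poly (translation_sum n e d g) 0 = (\<Sum>i\<in>{j}. complex_of_real (e i) * poly g (complex_of_real (d i)))"
        unfolding poly_translation_sum add_0
      proof (rule sum.mono_neutral_right)
        show "\<forall>i\<in>{1..n} - {j}. complex_of_real (e i) * poly g (complex_of_real (d i)) = 0"
          by (auto simp: gr)
      qed (use j in auto)
      then show ?thesis by simp
    qed
    have "poly (T' g) 0 = w 0 * poly g 0 + (a 1 - a 0) * poly (T g) 0"
      by (simp add: T'_relation[OF n])
    then show ?thesis
      using gr[of 0] gj c_nonzero[OF j(1)] by (simp add: only_j mult_ac)
  qed
  then have "complex_of_real (d j) = complex_of_real (d k)" using assms by simp
  then show ?thesis using d_inj_iff[OF assms(1,3)] by simp
qed

subsection \<open>The distribution\<close>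

lemma integrable_poly: "integrable M (\<lambda>\<omega>. poly p (X \<omega>))"
proof -
  have "integrable M (\<lambda>\<omega>. \<Sum>i\<le>degree p. coeff p i * X \<omega> ^ i)"
    using mom unfolding finite_moments_def
    by (intro Bochner_Integration.integrable_sum integrable_mult_right) auto
  then show ?thesis by (simp add: poly_altdef)
qed

lemma real_stein_identity:
  "(\<integral>\<omega>. (\<Sum>i=1..n. c i * poly p (X \<omega> + d i)) \<partial>M) =
     (\<integral>\<omega>. (X \<omega> - expectation X) * poly p (X \<omega>) \<partial>M)"
proof -
  define f where "f = map_poly complex_of_real p"
  have f: "poly f (complex_of_real x) = complex_of_real (poly p x)" for x
    unfolding f_def by (induction p) (simp_all add: map_poly_pCons)
  have "rv (T f) = (\<lambda>\<omega>. complex_of_real (\<Sum>i=1..n. c i * poly p (X \<omega> + d i)))"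
    by (simp add: fun_eq_iff poly_rv_def poly_translation_sum flip: f)
  moreover have "rv ([:- complex_of_real (expectation X), 1:] * f) =
      (\<lambda>\<omega>. complex_of_real ((X \<omega> - expectation X) * poly p (X \<omega>)))"
    by (simp add: fun_eq_iff poly_rv_def f algebra_simps)
  ultimately have "complex_of_real (\<integral>\<omega>. (\<Sum>i=1..n. c i * poly p (X \<omega> + d i)) \<partial>M) =
      complex_of_real (\<integral>\<omega>. (X \<omega> - expectation X) * poly p (X \<omega>) \<partial>M)"
    using stein_identity[of f] by (simp only: integral_complex_of_real)
  then show ?thesis by (simp only: of_real_eq_iff)
qed

lemma AE_eq_const_if_second_moment_0:
  assumes "(\<integral>\<omega>. (X \<omega> - t)\<^sup>2 \<partial>M) = 0"
  shows "AE \<omega> in M. X \<omega> = t"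
proof -
  have "integrable M (\<lambda>\<omega>. (X \<omega> - t)\<^sup>2)"
    using integrable_poly[of "[:- t, 1:] ^ 2"] by simp
  then have "AE \<omega> in M. (X \<omega> - t)\<^sup>2 = 0"
    using assms by (subst (asm) integral_nonneg_eq_0_iff_AE) simp_all
  then show ?thesis by simp
qed

text \<open>The empty sum makes the left side of the Stein identity 0; testing with
  \<open>x - expectation X\<close> gives zero variance.\<close>

lemma constant_if_no_translations:
  assumes "n = 0"
  shows "AE \<omega> in M. X \<omega> = expectation X"
  using real_stein_identity[of "[:- expectation X, 1:]"] assms
  by (intro AE_eq_const_if_second_moment_0) (simp add: power2_eq_square)

lemma real_translation_sum_single:
  assumes j: "j \<in> {1..n}" and only: "\<And>i. i \<in> {1..n} \<Longrightarrow> i \<noteq> j \<Longrightarrow> d i = 0"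
  shows "(\<Sum>i=1..n. c i * poly p (x + d i)) = c j * (poly p (x + d j) - poly p x)"
proof -
  have "(\<Sum>i=1..n. c i * poly p (x + d i)) = c j * poly p (x + d j) + (\<Sum>i\<in>{1..n}-{j}. c i * poly p (x + d i))"
    using j by (simp add: sum.remove)
  also have "(\<Sum>i\<in>{1..n}-{j}. c i * poly p (x + d i)) = (\<Sum>i\<in>{1..n}-{j}. c i) * poly p x"
    using only by (simp add: sum_distrib_right)
  also have "(\<Sum>i\<in>{1..n}-{j}. c i) = - c j"
    using j c_sum by (simp add: sum.remove)
  finally show ?thesis by (simp add: algebra_simps)
qed

lemma single_translation_poisson:
  assumes j: "j \<in> {1..n}" "d j \<noteq> 0" and only: "\<And>i. i \<in> {1..n} \<Longrightarrow> i \<noteq> j \<Longrightarrow> d i = 0"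
  shows "c j / d j > 0"
    and "distr M borel X =
      distr (measure_pmf (poisson_pmf (c j / d j))) borel (\<lambda>k. expectation X - c j + d j * real k)"
proof -
  let ?m = "expectation X"
  have T_eq: "(\<Sum>i=1..n. c i * poly p (x + d i)) = c j * (poly p (x + d j) - poly p x)" for p x
    using j(1) only by (rule real_translation_sum_single)
  have stein: "(\<integral>\<omega>. c j * (poly p (X \<omega> + d j) - poly p (X \<omega>)) \<partial>M) =
      (\<integral>\<omega>. (X \<omega> - ?m) * poly p (X \<omega>) \<partial>M)" for p
    using real_stein_identity[of p] unfolding T_eq .
  \<comment> \<open>The variance equals \<open>c j * d j\<close>, so its positivity decides the sign
    of \<open>c j / d j\<close>. Zero variance would make a linear polynomial vanish almost
    surely.\<close>
  have "(\<integral>\<omega>. (X \<omega> - ?m)\<^sup>2 \<partial>M) \<noteq> 0"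
  proof
    assume "(\<integral>\<omega>. (X \<omega> - ?m)\<^sup>2 \<partial>M) = 0"
    then have "AE \<omega> in M. rv [:- complex_of_real ?m, 1:] \<omega> = 0"
      using AE_eq_const_if_second_moment_0 by (simp add: poly_rv_def)
    then show False using rv_eq_0_imp_poly_eq_0[of "[:- complex_of_real ?m, 1:]"] j(1) by simp
  qed
  moreover have "(\<integral>\<omega>. (X \<omega> - ?m)\<^sup>2 \<partial>M) \<ge> 0" by simp
  moreover have "(\<integral>\<omega>. (X \<omega> - ?m)\<^sup>2 \<partial>M) = c j * d j"
    using stein[of "[:- ?m, 1:]"] by (simp add: power2_eq_square prob_space)
  ultimately have "c j * d j > 0" by linarith
  then show pos: "c j / d j > 0"
    by (simp add: zero_less_divide_iff zero_less_mult_iff)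
  \<comment> \<open>If \<open>X = b + d j * Y\<close> with \<open>Y\<close> of mean
    \<open>c j / d j\<close>, taking expectations forces this \<open>b\<close>.\<close>
  define b where "b = ?m - c j"
  define Z where "Z = (\<lambda>\<omega>. (X \<omega> - b) / d j)"
  have [measurable]: "Z \<in> borel_measurable M" unfolding Z_def by measurable
  have Zk: "poly ([:- b / d j, 1 / d j:] ^ k) (X \<omega>) = Z \<omega> ^ k" for k \<omega>
    by (simp add: Z_def diff_divide_distrib)
  have Zk': "poly ([:- b / d j, 1 / d j:] ^ k) (X \<omega> + d j) = (Z \<omega> + 1) ^ k" for k \<omega>
    using j(2) by (simp add: Z_def diff_divide_distrib add_divide_distrib diff_add_eq)
  have int: "integrable M (\<lambda>\<omega>. Z \<omega> ^ k)" for k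
    using integrable_poly[of "[:- b / d j, 1 / d j:] ^ k"] by (simp only: Zk)
  have int': "integrable M (\<lambda>\<omega>. (Z \<omega> + 1) ^ k)" for k
    using int by (simp add: binomial_ring)
  have "expectation (\<lambda>\<omega>. Z \<omega> ^ Suc k) = c j / d j * expectation (\<lambda>\<omega>. (Z \<omega> + 1) ^ k)" for k
  proof -
    have X: "X \<omega> - ?m = d j * Z \<omega> - c j" for \<omega>
      using j(2) by (simp add: Z_def b_def)
    \<comment> \<open>The choice of \<open>b\<close> makes the terms
      \<open>c j * Z \<omega> ^ k\<close> cancel, which leaves the Poisson recursion.\<close>
    have "(\<integral>\<omega>. c j * (Z \<omega> + 1) ^ k - c j * Z \<omega> ^ k \<partial>M) = (\<integral>\<omega>. d j * Z \<omega> ^ Suc k - c j * Z \<omega> ^ k \<partial>M)"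
      using stein[of "[:- b / d j, 1 / d j:] ^ k"] unfolding Zk Zk' X
      by (simp only: right_diff_distrib left_diff_distrib power_Suc mult.assoc)
    then have "c j * expectation (\<lambda>\<omega>. (Z \<omega> + 1) ^ k) = d j * expectation (\<lambda>\<omega>. Z \<omega> ^ Suc k)"
      using int int' int[of "Suc k"] by (simp del: power_Suc)
    then show ?thesis using j(2) by (simp add: field_simps)
  qed
  then have Z: "distr M borel Z = distr (measure_pmf (poisson_pmf (c j / d j))) borel real"
    using poisson_if_moment_recursion[OF _ pos int] by simp
  have "distr M borel X = distr (distr M borel Z) borel (\<lambda>z. b + d j * z)"
    using j(2) by (subst distr_distr) (auto simp: Z_def o_def)
  also have "\<dots> = distr (measure_pmf (poisson_pmf (c j / d j))) borel (\<lambda>k. b + d j * real k)"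
    unfolding Z by (subst distr_distr) (auto simp: o_def)
  finally show "distr M borel X =
      distr (measure_pmf (poisson_pmf (c j / d j))) borel (\<lambda>k. ?m - c j + d j * real k)"
    by (simp add: b_def)
qed

end

theorem mainTheorem4:
  fixes M :: "'a measure" and X :: "'a \<Rightarrow> real"
    and A :: "('a \<Rightarrow> complex) \<Rightarrow> 'a \<Rightarrow> complex"
    and n :: nat and c d :: "nat \<Rightarrow> real"
  assumes "prob_space M"
    and "X \<in> borel_measurable M"
    and "finite_moments M X"
    and "is_annihilation_operator M X A"
    and "\<And>i. i \<in> {1..n} \<Longrightarrow> c i \<noteq> 0"
    and "(\<Sum>i=1..n. c i) = 0"
    and "inj_on d {1..n}"
    and "\<And>f :: complex poly. AE \<omega> in M.
           A (poly_rv f X) \<omega> =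
             (\<Sum>i=1..n. complex_of_real (c i) * translate_rv (complex_of_real (d i)) f X \<omega>)"
  shows "(\<forall>i\<in>{1..n}. d i \<noteq> 0 \<longrightarrow> c i / d i > 0) \<and>
    (\<exists>(b::real) (N :: (nat \<Rightarrow> nat) measure) (Y :: nat \<Rightarrow> (nat \<Rightarrow> nat) \<Rightarrow> nat).
       prob_space N \<and>
       prob_space.indep_vars N (\<lambda>_. count_space UNIV) Y {i\<in>{1..n}. d i \<noteq> 0} \<and>
       (\<forall>i\<in>{i\<in>{1..n}. d i \<noteq> 0}.
          distr N (count_space UNIV) (Y i) = measure_pmf (poisson_pmf (c i / d i))) \<and>
       distr M borel X =
         distr N borel (\<lambda>\<omega>. b + (\<Sum>i\<in>{i\<in>{1..n}. d i \<noteq> 0}. d i * real (Y i \<omega>))))"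
proof -
  interpret translation_annihilation M X A n c d
    by (intro translation_annihilation.intro translation_annihilation_axioms.intro assms)
  define I where "I = {i\<in>{1..n}. d i \<noteq> 0}"
  \<comment> \<open>The product distribution on \<open>I\<close>, with default value 0 outside; the
    coordinates serve as the \<open>Y i\<close>.\<close>
  define N where "N = measure_pmf (Pi_pmf I 0 (\<lambda>i. poisson_pmf (c i / d i)))"
  have finI: "finite I" by (simp add: I_def)
  have N: "prob_space N" unfolding N_def by (rule measure_pmf.prob_space_axioms)
  have indep: "prob_space.indep_vars N (\<lambda>_. count_space UNIV) (\<lambda>i \<omega>. \<omega> i) I"
    unfolding N_def by (rule indep_vars_Pi_pmf[OF finI])
  have marginal: "distr N (count_space UNIV) (\<lambda>\<omega>. \<omega> i) = measure_pmf (poisson_pmf (c i / d i))"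
    if "i \<in> I" for i
    using Pi_pmf_component[OF finI, of i 0 "\<lambda>i. poisson_pmf (c i / d i)"] that
    by (simp add: N_def flip: map_pmf_rep_eq)
  have "(\<forall>i\<in>I. c i / d i > 0) \<and>
    (\<exists>b. distr M borel X = distr N borel (\<lambda>\<omega>. b + (\<Sum>i\<in>I. d i * real (\<omega> i))))"
  \<comment> \<open>For \<open>n = 0\<close> the sum is empty and \<open>b\<close> is the mean;
    otherwise \<open>I\<close> is a singleton.\<close>
  proof (cases "n = 0")
    case True
    then have I: "I = {}" by (simp add: I_def)
    have "distr M borel X = distr M borel (\<lambda>_. expectation X)"
      using constant_if_no_translations[OF True] by (intro distr_cong_AE) auto
    also have "\<dots> = distr N borel (\<lambda>_. expectation X)"
      using prob_space.distr_const[OF N, of "expectation X" borel] by (simp add: distr_const)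
    finally show ?thesis using I by auto
  next
    case False
    then obtain j where j: "j \<in> {1..n}" "d j \<noteq> 0"
      using nonzero_translation_exists by force
    have only: "d i = 0" if "i \<in> {1..n}" "i \<noteq> j" for i
      using nonzero_translation_unique[OF that(1) _ j] that(2) by blast
    have I: "I = {j}" using j only by (auto simp: I_def)
    let ?b = "expectation X - c j"
    have "distr M borel X = distr (distr N (count_space UNIV) (\<lambda>\<omega>. \<omega> j)) borel (\<lambda>k. ?b + d j * real k)"
      using single_translation_poisson(2)[OF j only] marginal[of j] I by simp
    also have "\<dots> = distr N borel (\<lambda>\<omega>. ?b + d j * real (\<omega> j))"
      by (subst distr_distr) (auto simp: o_def N_def)
    finally show ?thesis using single_translation_poisson(1)[OF j only] I by auto
  qed
  then obtain b where pos: "\<forall>i\<in>I. c i / d i > 0"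
    and b: "distr M borel X = distr N borel (\<lambda>\<omega>. b + (\<Sum>i\<in>I. d i * real (\<omega> i)))"
    by blast
  show ?thesis
    unfolding I_def[symmetric]
  proof (intro conjI exI[of _ b] exI[of _ N] exI[of _ "\<lambda>i \<omega>. \<omega> i"])
    show "\<forall>i\<in>{1..n}. d i \<noteq> 0 \<longrightarrow> c i / d i > 0" using pos by (simp add: I_def)
  qed (use N indep marginal b in auto)
qed

end
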